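(* Let $\mathbb{H}$ be a separable complex Hilbert space and $T\in\mathbb{L}(\mathbb{H})$ with $\|T\|=1$. Then $T$ is $n^2$-smooth if and only if $M_T=S_{H_0}$, where $H_0$ is a finite-dimensional subspace of $\mathbb{H}$ with $\dim(H_0)=n$, and $\|T|_{H_0^\perp}\|<1$. If $\mathbb{H}$ is a separable real Hilbert space, the same holds with $n^2$-smoothness replaced by $\binom{n+1}{2}$-smoothness.
   Context: $\mathbb{L}(\mathbb{H})$ is the space of bounded linear operators on $\mathbb{H}$ with the operator norm; $S_{H_0}$ is the unit sphere of $H_0$; $M_T=\{x\in\mathbb{H}:\|x\|=1,\ \|Tx\|=\|T\|\}$. For a Banach space $\mathbb{Z}$ and a unit vector $z$, $J(z)=\{f\in \mathbb{Z}^*:\|f\|=1,\ f(z)=1\}$; $z$ is $k$-smooth if $\dim\operatorname{span} J(z)=k$. $T$ is $k$-smooth if it is a $k$-smooth point of the unit sphere of $\mathbb{L}(\mathbb{H})$. *)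

theory Defs
  imports "HOL-Analysis.Analysis" "HOL-Library.Function_Algebras"
begin

class complex_vector = real_vector +
  fixes scaleC :: "complex \<Rightarrow> 'a \<Rightarrow> 'a"
  assumes scaleC_add_right: "scaleC c (x + y) = scaleC c x + scaleC c y"
    and scaleC_add_left: "scaleC (c + d) x = scaleC c x + scaleC d x"
    and scaleC_scaleC: "scaleC c (scaleC d x) = scaleC (c * d) x"
    and scaleC_one: "scaleC 1 x = x"
    and scaleR_scaleC: "scaleR r x = scaleC (complex_of_real r) x"

class complex_inner = complex_vector + real_normed_vector +
  fixes cinner :: "'a \<Rightarrow> 'a \<Rightarrow> complex"
  assumes cinner_cnj: "cinner x y = cnj (cinner y x)"
    and cinner_add_left: "cinner (x + y) z = cinner x z + cinner y z"
    and cinner_scaleC_left: "cinner (scaleC c x) y = cnj c * cinner x y"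
    and cinner_self_norm: "cinner x x = complex_of_real ((norm x)\<^sup>2)"

text \<open>A complex Hilbert space is a type of class complex_inner + complete_space;
  a real Hilbert space is a type of class real_inner + complete_space.\<close>

definition separable :: "'a::topological_space itself \<Rightarrow> bool" where
  "separable _ \<longleftrightarrow> separable_space (euclidean :: 'a topology)"

definition norm_attaining_set :: "('a::real_normed_vector \<Rightarrow>\<^sub>L 'a) \<Rightarrow> 'a set" where
  "norm_attaining_set T = {x. norm x = 1 \<and> norm (blinfun_apply T x) = norm T}"

definition unit_sphere_of :: "'a::real_normed_vector set \<Rightarrow> 'a set" where
  "unit_sphere_of V = {x \<in> V. norm x = 1}"

definition restr_norm :: "('a::real_normed_vector \<Rightarrow>\<^sub>L 'a) \<Rightarrow> 'a set \<Rightarrow> real" where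
  "restr_norm T V = Sup {norm (blinfun_apply T x) | x. x \<in> V \<and> norm x \<le> 1}"

definition cbounded_ops :: "('a::complex_inner \<Rightarrow>\<^sub>L 'a) set" where
  "cbounded_ops = {T. \<forall>c x. blinfun_apply T (scaleC c x) = scaleC c (blinfun_apply T x)}"

definition cdual :: "(('a::complex_inner \<Rightarrow>\<^sub>L 'a) \<Rightarrow> complex) set" where
  "cdual = {f. (\<forall>A\<in>cbounded_ops. \<forall>B\<in>cbounded_ops. f (A + B) = f A + f B)
             \<and> (\<forall>A\<in>cbounded_ops. \<forall>B\<in>cbounded_ops. \<forall>c.
                   (\<forall>x. blinfun_apply B x = scaleC c (blinfun_apply A x)) \<longrightarrow> f B = c * f A)
             \<and> (\<forall>A. A \<notin> cbounded_ops \<longrightarrow> f A = 0)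
             \<and> (\<exists>K. \<forall>A\<in>cbounded_ops. cmod (f A) \<le> K * norm A)}"

definition cdual_norm :: "(('a::complex_inner \<Rightarrow>\<^sub>L 'a) \<Rightarrow> complex) \<Rightarrow> real" where
  "cdual_norm f = Sup {cmod (f A) | A. A \<in> cbounded_ops \<and> norm A \<le> 1}"

definition cJ :: "('a::complex_inner \<Rightarrow>\<^sub>L 'a) \<Rightarrow> (('a \<Rightarrow>\<^sub>L 'a) \<Rightarrow> complex) set" where
  "cJ T = {f \<in> cdual. cdual_norm f = 1 \<and> f T = 1}"

definition fscaleC :: "complex \<Rightarrow> ('b \<Rightarrow> complex) \<Rightarrow> ('b \<Rightarrow> complex)" where
  "fscaleC c f = (\<lambda>A. c * f A)"

definition c_k_smooth :: "nat \<Rightarrow> ('a::complex_inner \<Rightarrow>\<^sub>L 'a) \<Rightarrow> bool" where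
  "c_k_smooth k T \<longleftrightarrow> T \<in> cbounded_ops \<and> norm T = 1 \<and>
     (\<exists>B. finite B \<and> card B = k \<and> \<not> module.dependent fscaleC B \<and>
          module.span fscaleC B = module.span fscaleC (cJ T))"

definition csubspace_dim :: "'a::complex_inner set \<Rightarrow> nat \<Rightarrow> bool" where
  "csubspace_dim V n \<longleftrightarrow> module.subspace scaleC V \<and>
     (\<exists>B. finite B \<and> card B = n \<and> \<not> module.dependent scaleC B \<and> module.span scaleC B = V)"

definition corth_comp :: "'a::complex_inner set \<Rightarrow> 'a set" where
  "corth_comp V = {x. \<forall>y\<in>V. cinner y x = 0}"

text \<open>Here L(H) is the whole type of bounded (real-)linear operators, its dual is
  ('a \<Rightarrow>L 'a) \<Rightarrow>L real with the operator norm.\<close>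
definition rJ :: "('a::real_inner \<Rightarrow>\<^sub>L 'a) \<Rightarrow> (('a \<Rightarrow>\<^sub>L 'a) \<Rightarrow>\<^sub>L real) set" where
  "rJ T = {f. norm f = 1 \<and> blinfun_apply f T = 1}"

definition r_k_smooth :: "nat \<Rightarrow> ('a::real_inner \<Rightarrow>\<^sub>L 'a) \<Rightarrow> bool" where
  "r_k_smooth k T \<longleftrightarrow> norm T = 1 \<and>
     (\<exists>B. finite B \<and> card B = k \<and> independent B \<and> span B = span (rJ T))"

definition rsubspace_dim :: "'a::real_inner set \<Rightarrow> nat \<Rightarrow> bool" where
  "rsubspace_dim V n \<longleftrightarrow> subspace V \<and>
     (\<exists>B. finite B \<and> card B = n \<and> independent B \<and> span B = V)"

end

theory Submission
  imports Defs
begin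

text \<open>
  Let \<open>H\<^sub>0 = {x. \<parallel>T x\<parallel> = \<parallel>x\<parallel>}\<close>, which for a contraction \<open>T\<close> is a subspace. If it is finite-dimensional and \<open>T\<close> is
  strictly contractive on its complement, then \<open>\<parallel>T + \<epsilon> A\<parallel>\<^sup>2 \<le> 1 + C \<epsilon>\<^sup>2\<close> whenever \<open>\<langle>T x, A x\<rangle> = 0\<close> for
  all \<open>x \<in> H\<^sub>0\<close>, so every support functional at \<open>T\<close> vanishes on such \<open>A\<close>. Hence the support functionals
  span the same space as the functionals \<open>A \<mapsto> \<langle>T x, A x\<rangle>\<close> with \<open>x \<in> H\<^sub>0\<close>, and polarization gives its dimension.

  Conversely, if \<open>T\<close> is strictly contractive on no subspace of finite codimension, there is an orthonormal
  sequence \<open>x\<^sub>m\<close> with \<open>\<parallel>T x\<^sub>m\<parallel> \<rightarrow> 1\<close>. Cluster points of \<open>A \<mapsto> \<langle>T x\<^sub>m, A x\<^sub>m\<rangle>\<close> along disjoint subsequences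
  are then arbitrarily many linearly independent support functionals. Otherwise \<open>H\<^sub>0\<close> is finite-dimensional,
  and a compactness argument bounds \<open>T\<close> away from norm 1 on its complement.

  The real and the complex case are treated together, over a scalar field with a conjugation \<open>cn\<close>.
\<close>

section \<open>Biorthogonal systems and compactness\<close>

text \<open>One notion of span for functionals over either scalar field; for complex scalars it
  coincides with \<open>fscaleC\<close>.\<close>

definition fscale :: "'k::field \<Rightarrow> ('b \<Rightarrow> 'k) \<Rightarrow> 'b \<Rightarrow> 'k" where
  "fscale c f = (\<lambda>A. c * f A)"

interpretation F: vector_space fscale
  by unfold_locales (auto simp: fscale_def fun_eq_iff algebra_simps)

lemma sum_fun_apply: "(\<Sum>i\<in>I. f i) x = (\<Sum>i\<in>I. f i x)"
  by (induction I rule: infinite_finite_induct) auto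

lemma biorthogonal_independent:
  assumes "finite I" and "\<And>i j. i \<in> I \<Longrightarrow> j \<in> I \<Longrightarrow> w i (a j) = (if i = j then 1 else 0)"
  shows "inj_on w I" "F.independent (w ` I)"
proof -
  show inj: "inj_on w I"
    by (intro inj_onI) (metis assms(2) zero_neq_one)
  show "F.independent (w ` I)"
  proof (rule F.independent_if_scalars_zero)
    fix f x assume 0: "(\<Sum>x\<in>w ` I. fscale (f x) x) = 0" and "x \<in> w ` I"
    then obtain j where j: "j \<in> I" "x = w j" by auto
    have "0 = (\<Sum>x\<in>w ` I. fscale (f x) x) (a j)" using 0 by simp
    also have "\<dots> = (\<Sum>i\<in>I. f (w i) * w i (a j))"
      by (simp add: sum.reindex[OF inj] sum_fun_apply fscale_def)
    also have "\<dots> = (\<Sum>i\<in>I. if i = j then f (w j) else 0)"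
      by (intro sum.cong) (auto simp: assms(2) j)
    also have "\<dots> = f x" using j assms(1) by simp
    finally show "f x = 0" by simp
  qed (use assms(1) in simp)
qed

lemma biorthogonal_card_le:
  assumes "finite I" and "\<And>i j. i \<in> I \<Longrightarrow> j \<in> I \<Longrightarrow> w i (a j) = (if i = j then 1 else 0)"
    and "finite S" "w ` I \<subseteq> F.span S"
  shows "card I \<le> card S"
  using F.independent_span_bound[OF assms(3) biorthogonal_independent(2)[where w=w and a=a] assms(4)]
    card_image[OF biorthogonal_independent(1)[where w=w and a=a and I=I]] assms(1,2) by auto

text \<open>Tychonoff's theorem, used as a substitute for Banach limits: the filter makes a bounded
  sequence of functions converge pointwise.\<close>

lemma bounded_functions_cluster:
  fixes g :: "nat \<Rightarrow> 'b \<Rightarrow> 'k::{real_normed_vector,heine_borel}"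
  assumes "\<And>m A. norm (g m A) \<le> b A"
  obtains F f where "F \<noteq> bot" "F \<le> sequentially" "\<And>A. ((\<lambda>m. g m A) \<longlongrightarrow> f A) F"
proof -
  let ?K = "PiE UNIV (\<lambda>A. cball (0::'k) (b A))"
  have "compactin (product_topology (\<lambda>A::'b. euclidean :: 'k topology) UNIV) ?K"
    by (simp add: compactin_PiE)
  then have K: "compact ?K" by (simp add: euclidean_product_topology)
  have "eventually (\<lambda>f. f \<in> ?K) (filtermap g sequentially)"
    using assms by (simp add: eventually_filtermap PiE_def Pi_def extensional_def)
  then obtain f where f: "inf (nhds f) (filtermap g sequentially) \<noteq> bot"
    using K[unfolded compact_filter, rule_format, of "filtermap g sequentially"]
    by (auto simp: filtermap_bot_iff)
  \<comment> \<open>The refinement of \<open>sequentially\<close> by the preimages of neighbourhoods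
    of \<open>f\<close>. It is proper precisely because \<open>f\<close> is a cluster point of
    \<open>g\<close>.\<close>
  define F where "F = inf sequentially (filtercomap g (nhds f))"
  have "F \<noteq> bot"
  proof
    assume "F = bot"
    then have "eventually (\<lambda>x. False) (inf sequentially (filtercomap g (nhds f)))"
      by (simp add: F_def)
    then obtain P Q where "eventually P sequentially" "eventually Q (nhds f)" "\<And>m. P m \<Longrightarrow> Q (g m) \<Longrightarrow> False"
      unfolding eventually_inf eventually_filtercomap by meson
    then have "eventually (\<lambda>h. \<not> Q h) (filtermap g sequentially)" "eventually Q (nhds f)"
      by (auto simp: eventually_filtermap elim!: eventually_mono[of P])
    then have "eventually (\<lambda>x. False) (inf (nhds f) (filtermap g sequentially))"
      unfolding eventually_inf by blast
    then show False using f by (simp add: eventually_False)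
  qed
  moreover have lim: "(g \<longlongrightarrow> f) F"
    unfolding F_def filterlim_def
    by (metis filtermap_filtercomap filtermap_mono inf.cobounded2 order_trans)
  have "((\<lambda>m. g m A) \<longlongrightarrow> f A) F" for A
    using continuous_on_tendsto_compose[OF continuous_on_product_then_coordinatewise[OF continuous_on_id] lim, of UNIV]
    by simp
  ultimately show thesis using that[of F f] by (simp add: F_def)
qed

text \<open>Subsequences are extracted for one index after another; each further extraction keeps
  the limits already obtained.\<close>

lemma convergent_subsequence_finite:
  fixes g :: "'i \<Rightarrow> nat \<Rightarrow> 'k::{real_normed_vector,heine_borel}"
  assumes "finite I" and "\<And>i m. i \<in> I \<Longrightarrow> norm (g i m) \<le> b i"
  shows "\<exists>r. strict_mono r \<and> (\<forall>i\<in>I. convergent (\<lambda>m. g i (r m)))"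
  using assms
proof (induction I rule: finite_induct)
  case empty
  show ?case by (rule exI[of _ id]) (simp add: strict_mono_def)
next
  case (insert j I)
  then obtain r where r: "strict_mono r" "\<forall>i\<in>I. convergent (\<lambda>m. g i (r m))" by auto
  have "bounded (range (\<lambda>m. g j (r m)))"
    using insert.prems by (auto simp: bounded_iff)
  then obtain l s where s: "strict_mono (s::nat\<Rightarrow>nat)" "((\<lambda>m. g j (r m)) \<circ> s) \<longlonglongrightarrow> l"
    using bounded_imp_convergent_subsequence by blast
  have "convergent (\<lambda>m. g i (r (s m)))" if "i \<in> insert j I" for i
    using that r s convergent_subseq_convergent[of "\<lambda>m. g i (r m)" s]
    by (auto simp: o_def convergent_def)
  then show ?case
    using strict_mono_o[OF r(1) s(1)] by (intro exI[of _ "r \<circ> s"]) (simp add: o_def)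
qed

section \<open>Hilbert spaces over a field with conjugation\<close>

text \<open>\<open>cn\<close> becomes the identity for real scalars and \<open>cnj\<close> for
  complex ones. As with \<open>cinner\<close>, the form is conjugate-linear in its first argument.
  The class \<open>heine_borel\<close> provides the compact balls of scalars from which limit
  functionals are obtained.\<close>

locale hilbert_over = vector_space scale
  for scale :: "'k::{real_normed_field,heine_borel} \<Rightarrow> 'a::{real_normed_vector,complete_space} \<Rightarrow> 'a" +
  fixes ip :: "'a \<Rightarrow> 'a \<Rightarrow> 'k" and cn :: "'k \<Rightarrow> 'k"
  assumes scaleR_eq: "r *\<^sub>R x = scale (of_real r) x"
    and cn_add: "cn (c + d) = cn c + cn d"
    and cn_mult: "cn (c * d) = cn c * cn d"
    and cn_cn: "cn (cn c) = c"
    and cn_of_real: "cn (of_real r) = of_real r"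
    and cn_mult_self: "cn c * c = of_real ((norm c)\<^sup>2)"
    and ip_cn: "cn (ip y x) = ip x y"
    and ip_add_left: "ip (x + y) z = ip x z + ip y z"
    and ip_scale_left: "ip (scale c x) y = cn c * ip x y"
    and ip_self: "ip x x = of_real ((norm x)\<^sup>2)"
begin

section \<open>Inner product identities over the abstract scalars\<close>

lemma cn_0: "cn 0 = 0" and cn_1: "cn 1 = 1"
  using cn_of_real[of 0] cn_of_real[of 1] by auto

lemma norm_cn: "norm (cn c) = norm c"
proof (cases "c = 0")
  case False
  have "norm (cn c) * norm c = (norm c)\<^sup>2"
    by (metis cn_mult_self norm_mult norm_of_real abs_power2)
  then show ?thesis using False by (simp add: power2_eq_square)
qed (simp add: cn_0)

lemma ip_add_right: "ip x (y + z) = ip x y + ip x z"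
  by (metis ip_cn ip_add_left cn_add)

lemma ip_scale_right: "ip x (scale c y) = c * ip x y"
  by (metis ip_cn ip_scale_left cn_mult cn_cn)

lemma ip_scaleR_left: "ip (r *\<^sub>R x) y = r *\<^sub>R ip x y"
  by (simp add: scaleR_eq ip_scale_left cn_of_real scaleR_conv_of_real)

lemma ip_scaleR_right: "ip x (r *\<^sub>R y) = r *\<^sub>R ip x y"
  by (simp add: scaleR_eq ip_scale_right scaleR_conv_of_real)

lemma ip_0 [simp]: "ip 0 x = 0" "ip x 0 = 0"
  using ip_scaleR_left[of 0 0 x] ip_scaleR_right[of x 0 0] by auto

lemma ip_diff_right: "ip z (x - y) = ip z x - ip z y"
  using ip_add_right[of z "x - y" y] by simp

lemma ip_sum_right: "ip x (\<Sum>i\<in>I. f i) = (\<Sum>i\<in>I. ip x (f i))"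
  by (induction I rule: infinite_finite_induct) (auto simp: ip_add_right)

lemma ip_eq_0_sym: "ip x y = 0 \<longleftrightarrow> ip y x = 0"
  by (metis ip_cn cn_0)

lemma norm_scale: "norm (scale c x) = norm c * norm x"
proof -
  have "(of_real ((norm (scale c x))\<^sup>2) :: 'k) = cn c * c * ip x x"
    unfolding ip_self[symmetric] ip_scale_left ip_scale_right by (simp only: ac_simps)
  also have "\<dots> = of_real ((norm c * norm x)\<^sup>2)"
    unfolding cn_mult_self ip_self power_mult_distrib by simp
  finally show ?thesis
    by (metis of_real_eq_iff power2_eq_iff_nonneg norm_ge_zero mult_nonneg_nonneg)
qed

text \<open>The identity lives in \<open>'k\<close> because the abstract scalars have no real part
  to take; \<open>norm_add_square_le\<close> is its real-valued consequence.\<close>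

lemma norm_add_square:
  "of_real ((norm (x + y))\<^sup>2) = of_real ((norm x)\<^sup>2) + ip x y + ip y x + of_real ((norm y)\<^sup>2)"
  unfolding ip_self[symmetric] ip_add_left ip_add_right by simp

lemma pythagoras:
  assumes "ip x y = 0"
  shows "(norm (x + y))\<^sup>2 = (norm x)\<^sup>2 + (norm y)\<^sup>2"
proof -
  have "of_real ((norm (x + y))\<^sup>2) = (of_real ((norm x)\<^sup>2 + (norm y)\<^sup>2) :: 'k)"
    unfolding norm_add_square using assms ip_eq_0_sym by simp
  then show ?thesis by (simp only: of_real_eq_iff)
qed

lemma norm_add_square_le: "(norm (x + y))\<^sup>2 \<le> (norm x)\<^sup>2 + 2 * norm (ip x y) + (norm y)\<^sup>2"
proof -
  have "(norm (x + y))\<^sup>2 = norm (of_real ((norm (x + y))\<^sup>2) :: 'k)"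
    by (simp only: norm_of_real abs_power2)
  also have "\<dots> \<le> norm (of_real ((norm x)\<^sup>2) :: 'k) + norm (ip x y) + norm (ip y x) + norm (of_real ((norm y)\<^sup>2) :: 'k)"
    unfolding norm_add_square by (intro norm_triangle_le add_mono order_refl)
  also have "norm (ip y x) = norm (ip x y)" by (metis ip_cn norm_cn)
  finally show ?thesis by (simp only: norm_of_real abs_power2)
qed

lemma scale_ip_orthogonal:
  assumes "norm e = 1"
  shows "ip e (x - scale (ip e x) e) = 0"
  using assms by (simp add: ip_diff_right ip_scale_right ip_self)

text \<open>By Pythagoras the component \<open>scale (ip e y) e\<close> of \<open>y\<close> along a
  unit vector \<open>e\<close> is no longer than \<open>y\<close>.\<close>

lemma cauchy_schwarz: "norm (ip x y) \<le> norm x * norm y"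
proof (cases "x = 0")
  case False
  define e where "e = (1 / norm x) *\<^sub>R x"
  have e: "norm e = 1" using False by (simp add: e_def)
  have x: "x = norm x *\<^sub>R e" using False by (simp add: e_def)
  have "ip (scale (ip e y) e) (y - scale (ip e y) e) = 0"
    using scale_ip_orthogonal[OF e] by (simp add: ip_scale_left)
  from pythagoras[OF this] have "(norm (ip e y))\<^sup>2 \<le> (norm y)\<^sup>2"
    by (simp add: norm_scale e)
  then have "norm (ip e y) \<le> norm y" by (rule power2_le_imp_le) simp
  then show ?thesis
    by (subst x) (simp add: ip_scaleR_left mult_left_mono e)
qed simp

lemma bounded_bilinear_ip: "bounded_bilinear ip"
proof
  show "\<exists>K. \<forall>a b. norm (ip a b) \<le> norm a * norm b * K"
    using cauchy_schwarz by (intro exI[of _ 1]) simp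
qed (simp_all add: ip_add_left ip_add_right ip_scaleR_left ip_scaleR_right)

sublocale ip: bounded_bilinear ip by (rule bounded_bilinear_ip)

lemma parallelogram:
  fixes x y :: 'a
  shows "(norm (x + y))\<^sup>2 + (norm (x - y))\<^sup>2 = 2 * (norm x)\<^sup>2 + 2 * (norm y)\<^sup>2"
proof -
  have "of_real ((norm (x + y))\<^sup>2 + (norm (x - y))\<^sup>2) = (of_real (2 * (norm x)\<^sup>2 + 2 * (norm y)\<^sup>2) :: 'k)"
    using norm_add_square[of x y] norm_add_square[of x "- y"] ip.minus_left[of y x] ip.minus_right[of x y]
    by (simp only: of_real_add of_real_mult of_real_numeral) (simp del: of_real_power)
  then show ?thesis by (simp only: of_real_eq_iff)
qed

section \<open>Orthonormal sets, complements and projections\<close>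

definition orthonormal :: "'a set \<Rightarrow> bool" where
  "orthonormal E \<longleftrightarrow> (\<forall>x\<in>E. \<forall>y\<in>E. ip x y = (if x = y then 1 else 0))"

definition perp :: "'a set \<Rightarrow> 'a set" where
  "perp V = {x. \<forall>y\<in>V. ip y x = 0}"

lemma subspace_perp: "subspace (perp V)"
  by (auto simp: subspace_def perp_def ip_add_right ip_scale_right)

lemma perp_span: "perp (span V) = perp V"
proof
  show "perp V \<subseteq> perp (span V)"
  proof (clarsimp simp: perp_def)
    fix x y assume x: "\<forall>y\<in>V. ip y x = 0" and "y \<in> span V"
    from this(2) show "ip y x = 0"
      using x by (induction rule: span_induct_alt) (auto simp: ip_add_left ip_scale_left)
  qed
qed (auto simp: perp_def span_base)

lemma norm_eq_1: "ip x x = 1 \<Longrightarrow> norm x = 1"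
  by (metis ip_self of_real_eq_1_iff norm_ge_zero power2_eq_1_iff abs_of_nonneg abs_1 abs_minus_cancel)

lemma orthonormal_norm: "orthonormal E \<Longrightarrow> e \<in> E \<Longrightarrow> norm e = 1"
  by (rule norm_eq_1) (simp add: orthonormal_def)

definition proj :: "'a set \<Rightarrow> 'a \<Rightarrow> 'a" where
  "proj E x = (\<Sum>e\<in>E. scale (ip e x) e)"

lemma proj_in_span: "proj E x \<in> span E"
  unfolding proj_def by (intro span_sum span_scale span_base)

lemma ip_proj:
  assumes "orthonormal E" "finite E" "e \<in> E"
  shows "ip e (proj E x) = ip e x"
proof -
  have "ip e (proj E x) = (\<Sum>d\<in>E. if d = e then ip e x else 0)"
    unfolding proj_def ip_sum_right
    by (intro sum.cong) (use assms in \<open>auto simp: ip_scale_right orthonormal_def\<close>)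
  then show ?thesis using assms by simp
qed

lemma diff_proj_perp: "orthonormal E \<Longrightarrow> finite E \<Longrightarrow> x - proj E x \<in> perp E"
  by (simp add: perp_def ip_diff_right ip_proj)

lemma norm_proj:
  assumes "orthonormal E" "finite E"
  shows "(norm x)\<^sup>2 = (norm (proj E x))\<^sup>2 + (norm (x - proj E x))\<^sup>2"
proof -
  have "ip (proj E x) (x - proj E x) = 0"
    using proj_in_span[of E x] diff_proj_perp[OF assms, of x] perp_span[of E] by (auto simp: perp_def)
  from pythagoras[OF this] show ?thesis by simp
qed

lemma orthonormal_independent:
  assumes "orthonormal E" "finite E"
  shows "independent E"
proof (rule independent_if_scalars_zero[OF assms(2)])
  fix f e assume 0: "(\<Sum>x\<in>E. scale (f x) x) = 0" and e: "e \<in> E"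
  have "0 = ip e (\<Sum>x\<in>E. scale (f x) x)" using 0 by simp
  also have "\<dots> = (\<Sum>x\<in>E. if x = e then f e else 0)"
    unfolding ip_sum_right
    by (intro sum.cong) (use assms e in \<open>auto simp: ip_scale_right orthonormal_def\<close>)
  also have "\<dots> = f e" using assms e by simp
  finally show "f e = 0" by simp
qed

lemma orthonormal_insert:
  assumes "orthonormal E" "x \<in> perp E" "norm x = 1"
  shows "orthonormal (insert x E)"
  using assms ip_eq_0_sym unfolding orthonormal_def perp_def
  by (auto simp: ip_self)

text \<open>An orthonormal subset of \<open>V\<close> of largest cardinality spans \<open>V\<close>:
  otherwise the normalized residue of a missed vector would enlarge it. Finite dimension is a
  conclusion here, so that for \<open>isom T\<close> the bound can come from counting support
  functionals.\<close>

lemma orthonormal_basis_exists: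
  assumes V: "subspace V"
    and bound: "\<And>E. E \<subseteq> V \<Longrightarrow> finite E \<Longrightarrow> orthonormal E \<Longrightarrow> card E \<le> N"
  obtains E where "finite E" "orthonormal E" "span E = V"
proof -
  let ?P = "\<lambda>k. \<exists>E. E \<subseteq> V \<and> finite E \<and> orthonormal E \<and> card E = k"
  have "?P 0" by (rule exI[of _ "{}"]) (simp add: orthonormal_def)
  then obtain k where k: "?P k" and max: "\<And>j. ?P j \<Longrightarrow> j \<le> k"
    using Nat.ex_has_greatest_nat[of ?P 0 N] bound by blast
  from k obtain E where E: "E \<subseteq> V" "finite E" "orthonormal E" "card E = k" by blast
  have "V \<subseteq> span E"
  proof
    fix x assume x: "x \<in> V"
    define z where "z = x - proj E x"
    have z: "z \<in> perp E" "z \<in> V"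
      using diff_proj_perp[OF E(3,2)] x proj_in_span[of E x] span_minimal[OF E(1) V] subspace_diff[OF V]
      by (auto simp: z_def)
    show "x \<in> span E"
    proof (cases "z = 0")
      case True
      then show ?thesis using proj_in_span[of E x] by (simp add: z_def)
    next
      case False
      define e where "e = (1 / norm z) *\<^sub>R z"
      have e: "norm e = 1" "e \<in> perp E" "e \<in> V"
        using False z subspace_scale[OF subspace_perp] subspace_scale[OF V]
        by (simp_all add: e_def norm_scale norm_divide scaleR_eq del: norm_scaleR)
      have "e \<notin> E" using e by (auto simp: perp_def ip_self)
      then have "Suc k \<le> k"
        using E e orthonormal_insert[OF E(3) e(2,1)] by (intro max exI[of _ "insert e E"]) auto
      then show ?thesis by simp
    qed
  qed
  then have "span E = V" using E(1) V span_subspace by blast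
  then show thesis using E that by blast
qed

lemma orthonormal_basis:
  assumes "subspace V" "finite B" "span B = V"
  obtains E where "finite E" "orthonormal E" "span E = V"
  using orthonormal_basis_exists[OF assms(1), of "card B"]
    independent_span_bound[OF assms(2) orthonormal_independent] assms(3) by blast

text \<open>The blinfun type consists of the bounded real-linear maps; in the complex case the
  operators in question are only part of it.\<close>

definition ops :: "('a \<Rightarrow>\<^sub>L 'a) set" where
  "ops = {T. \<forall>c x. blinfun_apply T (scale c x) = scale c (blinfun_apply T x)}"

lemma opsD: "T \<in> ops \<Longrightarrow> blinfun_apply T (scale c x) = scale c (blinfun_apply T x)"
  by (simp add: ops_def)

lemma ops_add: "A \<in> ops \<Longrightarrow> B \<in> ops \<Longrightarrow> A + B \<in> ops"
  by (simp add: ops_def blinfun.add_left scale_right_distrib)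

lemma ops_diff: "A \<in> ops \<Longrightarrow> B \<in> ops \<Longrightarrow> A - B \<in> ops"
  by (simp add: ops_def blinfun.diff_left scale_right_diff_distrib)

lemma ops_zero: "0 \<in> ops"
  by (simp add: ops_def)

lemma ops_sum: "(\<And>i. i \<in> I \<Longrightarrow> A i \<in> ops) \<Longrightarrow> (\<Sum>i\<in>I. A i) \<in> ops"
  by (induction I rule: infinite_finite_induct) (auto simp: ops_add ops_zero)

lemma bounded_linear_scale: "bounded_linear (scale c)"
  by (rule bounded_linear_intro[of _ "norm c"])
     (simp_all only: scale_right_distrib scaleR_eq scale_left_commute[of c] norm_scale mult.commute order_refl)

text \<open>The blinfun type carries only real scaling, so scaling by \<open>'k\<close> has to be
  built separately.\<close>

definition op_scale :: "'k \<Rightarrow> ('a \<Rightarrow>\<^sub>L 'a) \<Rightarrow> 'a \<Rightarrow>\<^sub>L 'a" where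
  "op_scale c A = Blinfun (\<lambda>x. scale c (blinfun_apply A x))"

lemma op_scale_apply [simp]: "blinfun_apply (op_scale c A) x = scale c (blinfun_apply A x)"
  unfolding op_scale_def
  by (subst bounded_linear_Blinfun_apply)
     (auto intro: bounded_linear_compose[OF bounded_linear_scale blinfun.bounded_linear_right])

lemma op_scale_ops: "A \<in> ops \<Longrightarrow> op_scale c A \<in> ops"
  by (simp add: ops_def scale_left_commute)

definition rank_one :: "'a \<Rightarrow> 'a \<Rightarrow> 'a \<Rightarrow>\<^sub>L 'a" where
  "rank_one u v = Blinfun (\<lambda>x. scale (ip v x) u)"

lemma rank_one_apply [simp]: "blinfun_apply (rank_one u v) x = scale (ip v x) u"
proof -
  have "bounded_linear (\<lambda>x. scale (ip v x) u)"
  proof (rule bounded_linear_intro[of _ "norm v * norm u"])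
    show "norm (scale (ip v x) u) \<le> norm x * (norm v * norm u)" for x
      using mult_right_mono[OF cauchy_schwarz norm_ge_zero, of v x u] by (simp add: norm_scale ac_simps)
  qed (simp_all add: ip_add_right scale_left_distrib ip_scale_right scaleR_eq)
  then show ?thesis unfolding rank_one_def by (simp add: bounded_linear_Blinfun_apply)
qed

lemma rank_one_ops: "rank_one u v \<in> ops"
  by (simp add: ops_def ip_scale_right)

section \<open>Support functionals\<close>

text \<open>Algebraic functionals; the norm bound is imposed in \<open>support\<close>. The default
  value 0 off \<open>ops\<close> makes a functional determined by its restriction to
  \<open>ops\<close>, so linear independence keeps its meaning.\<close>

definition dual :: "(('a \<Rightarrow>\<^sub>L 'a) \<Rightarrow> 'k) set" where
  "dual = {f. (\<forall>A\<in>ops. \<forall>B\<in>ops. f (A + B) = f A + f B) \<and>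
              (\<forall>A\<in>ops. \<forall>c. f (op_scale c A) = c * f A) \<and> (\<forall>A. A \<notin> ops \<longrightarrow> f A = 0)}"

text \<open>This is J(T) when \<open>norm T = 1\<close>: the value 1 at \<open>T\<close> makes the
  bound sharp, hence the functional has norm exactly 1.\<close>

definition support :: "('a \<Rightarrow>\<^sub>L 'a) \<Rightarrow> (('a \<Rightarrow>\<^sub>L 'a) \<Rightarrow> 'k) set" where
  "support T = {f \<in> dual. (\<forall>A\<in>ops. norm (f A) \<le> norm A) \<and> f T = 1}"

lemma dual_add: "f \<in> dual \<Longrightarrow> A \<in> ops \<Longrightarrow> B \<in> ops \<Longrightarrow> f (A + B) = f A + f B"
  and dual_op_scale: "f \<in> dual \<Longrightarrow> A \<in> ops \<Longrightarrow> f (op_scale c A) = c * f A"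
  and dual_off: "f \<in> dual \<Longrightarrow> A \<notin> ops \<Longrightarrow> f A = 0"
  by (auto simp: dual_def)

lemma dual_zero: "f \<in> dual \<Longrightarrow> f 0 = 0"
  using dual_add[of f 0 0] ops_zero by simp

lemma dual_diff: "f \<in> dual \<Longrightarrow> A \<in> ops \<Longrightarrow> B \<in> ops \<Longrightarrow> f (A - B) = f A - f B"
  using dual_add[of f "A - B" B] ops_diff[of A B] by simp

lemma dual_sum:
  assumes "f \<in> dual" "\<And>i. i \<in> I \<Longrightarrow> A i \<in> ops"
  shows "f (\<Sum>i\<in>I. A i) = (\<Sum>i\<in>I. f (A i))"
  using assms(2)
  by (induction I rule: infinite_finite_induct) (auto simp: dual_zero dual_add assms(1) ops_sum)

text \<open>The diagonal case \<open>x = y\<close> yields support functionals; the mixed case is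
  needed for polarization.\<close>

definition vf :: "('a \<Rightarrow>\<^sub>L 'a) \<Rightarrow> 'a \<Rightarrow> 'a \<Rightarrow> ('a \<Rightarrow>\<^sub>L 'a) \<Rightarrow> 'k" where
  "vf T x y A = (if A \<in> ops then ip (blinfun_apply T x) (blinfun_apply A y) else 0)"

lemma vf_dual: "vf T x y \<in> dual"
  by (auto simp: dual_def vf_def ops_add op_scale_ops blinfun.add_left ip_add_right ip_scale_right)

lemma norm_vf_le:
  assumes "norm T \<le> 1" "norm x = 1"
  shows "norm (vf T x x A) \<le> norm A"
proof -
  have "norm (ip (blinfun_apply T x) (blinfun_apply A x)) \<le> norm (blinfun_apply T x) * norm (blinfun_apply A x)"
    by (rule cauchy_schwarz)
  also have "\<dots> \<le> 1 * norm A"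
    using norm_blinfun[of T x] norm_blinfun[of A x] assms by (intro mult_mono) auto
  finally show ?thesis by (simp add: vf_def)
qed

lemma vf_support:
  assumes "T \<in> ops" "norm T \<le> 1" "norm x = 1" "norm (blinfun_apply T x) = 1"
  shows "vf T x x \<in> support T"
  using assms by (simp add: support_def vf_dual norm_vf_le) (simp add: vf_def ip_self)

section \<open>The isometric subspace and strict contraction\<close>

definition isom :: "('a \<Rightarrow>\<^sub>L 'a) \<Rightarrow> 'a set" where
  "isom T = {x. norm (blinfun_apply T x) = norm x}"

definition gap :: "('a \<Rightarrow>\<^sub>L 'a) \<Rightarrow> 'a set \<Rightarrow> bool" where
  "gap T V \<longleftrightarrow> (\<exists>r. 0 \<le> r \<and> r < 1 \<and> (\<forall>x\<in>V. norm (blinfun_apply T x) \<le> r * norm x))"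

lemma not_gapE:
  assumes "subspace V" "\<not> gap T V" "e > 0"
  obtains x where "x \<in> V" "norm x = 1" "norm (blinfun_apply T x) > 1 - e"
proof -
  \<comment> \<open>The constant in \<open>gap\<close> must be nonnegative, so \<open>max\<close>
    covers the case \<open>e > 1\<close>.\<close>
  obtain y where y: "y \<in> V" "norm (blinfun_apply T y) > max 0 (1 - e) * norm y"
    using assms unfolding gap_def by (metis max.cobounded1 max_less_iff_conj not_le diff_less_eq less_add_same_cancel1 zero_less_one)
  then have "y \<noteq> 0" by auto
  define x where "x = scale (of_real (1 / norm y)) y"
  have xR: "x = (1 / norm y) *\<^sub>R y" by (simp add: x_def scaleR_eq)
  have "x \<in> V" unfolding x_def by (rule subspace_scale[OF assms(1) y(1)])
  moreover have "norm x = 1" using \<open>y \<noteq> 0\<close> by (simp add: xR)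
  moreover have "norm (blinfun_apply T x) > max 0 (1 - e)"
    using y(2) \<open>y \<noteq> 0\<close> by (simp add: xR blinfun.scaleR_right pos_less_divide_eq del: max_less_iff_conj)
  ultimately show thesis using that by simp
qed

lemma norm_apply_le: "norm T \<le> 1 \<Longrightarrow> norm (blinfun_apply T x) \<le> norm x"
  by (metis norm_blinfun mult_right_mono norm_ge_zero mult_1 order_trans)

text \<open>The form \<open>ip x y - ip (T x) (T y)\<close> is positive semidefinite, so its isotropic vectors lie in
  its radical.\<close>

lemma isom_ip:
  assumes T: "T \<in> ops" "norm T \<le> 1" and x: "x \<in> isom T"
  shows "ip (blinfun_apply T x) (blinfun_apply T y) = ip x y"
proof (rule ccontr)
  let ?T = "blinfun_apply T"
  define b where "b = ip x y - ip (?T x) (?T y)"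
  define q where "q = (norm y)\<^sup>2 - (norm (?T y))\<^sup>2"
  assume "\<not> ?thesis"
  then have b: "norm b > 0" by (simp add: b_def)
  have q: "q \<ge> 0" unfolding q_def using norm_apply_le[OF T(2), of y] by (simp add: power_mono)
  \<comment> \<open>Since \<open>x\<close> is isotropic, the form at \<open>y + scale c x\<close>
    with \<open>c = - s b\<close> equals \<open>q - 2 * s * (norm b)\<^sup>2\<close>; this
    \<open>s\<close> makes it \<open>- q - 2\<close>, which is negative.\<close>
  define s where "s = (q + 1) / (norm b)\<^sup>2"
  define c where "c = - (of_real s * b)"
  let ?z = "y + scale c x"
  have b': "ip y x - ip (?T y) (?T x) = cn b"
  proof -
    have "cn b + cn (ip (?T x) (?T y)) = cn (ip x y)"
      by (simp flip: cn_add add: b_def)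
    then show ?thesis by (simp add: ip_cn algebra_simps)
  qed
  have Tz: "?T ?z = ?T y + scale c (?T x)" by (simp add: blinfun.add_right opsD[OF T(1)])
  have cnc: "cn c = - (of_real s * cn b)"
  proof -
    have "c = of_real (- s) * b" by (simp add: c_def)
    then show ?thesis by (simp only: cn_mult cn_of_real) simp
  qed
  have "of_real ((norm ?z)\<^sup>2 - (norm (?T ?z))\<^sup>2) = of_real q + c * (ip y x - ip (?T y) (?T x))
      + cn c * (ip x y - ip (?T x) (?T y))
      + (of_real ((norm (scale c x))\<^sup>2) - of_real ((norm (scale c (?T x)))\<^sup>2))"
    unfolding Tz of_real_diff norm_add_square q_def ip_scale_left ip_scale_right
    by (simp add: algebra_simps)
  also have "norm (scale c (?T x)) = norm (scale c x)"
    using x by (simp add: norm_scale isom_def)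
  also have "of_real q + c * (ip y x - ip (?T y) (?T x)) + cn c * (ip x y - ip (?T x) (?T y))
      + (of_real ((norm (scale c x))\<^sup>2) - of_real ((norm (scale c x))\<^sup>2))
      = of_real q - of_real (2 * s) * (cn b * b)"
    unfolding b' b_def[symmetric] cnc by (simp add: c_def algebra_simps)
  also have "\<dots> = of_real (q - 2 * s * (norm b)\<^sup>2)"
    by (simp add: cn_mult_self)
  finally have "(norm ?z)\<^sup>2 - (norm (?T ?z))\<^sup>2 = q - 2 * s * (norm b)\<^sup>2"
    by (simp only: of_real_eq_iff)
  moreover have "(norm ?z)\<^sup>2 - (norm (?T ?z))\<^sup>2 \<ge> 0"
    using norm_apply_le[OF T(2), of ?z] by (simp add: power_mono)
  moreover have "s * (norm b)\<^sup>2 = q + 1" using b by (simp add: s_def)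
  ultimately show False using q by simp
qed

text \<open>Describing \<open>isom T\<close> as the radical of the form turns a norm equation into
  linear conditions, from which the subspace property is immediate.\<close>

lemma isom_eq:
  assumes "T \<in> ops" "norm T \<le> 1"
  shows "isom T = {x. \<forall>y. ip (blinfun_apply T x) (blinfun_apply T y) = ip x y}"
proof -
  have "x \<in> isom T" if "\<forall>y. ip (blinfun_apply T x) (blinfun_apply T y) = ip x y" for x
  proof -
    have "(norm (blinfun_apply T x))\<^sup>2 = (norm x)\<^sup>2"
      using that[rule_format, of x] unfolding ip_self by (simp only: of_real_eq_iff)
    then show ?thesis by (simp add: isom_def)
  qed
  then show ?thesis using isom_ip[OF assms] by blast
qed

lemma subspace_isom:
  assumes "T \<in> ops" "norm T \<le> 1"
  shows "subspace (isom T)"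
  unfolding isom_eq[OF assms] subspace_def
  by (auto simp: blinfun.add_right opsD[OF assms(1)] ip_add_left ip_scale_left)

text \<open>Split \<open>z = x + y\<close> along \<open>isom T\<close> and its complement. The
  hypothesis on \<open>A\<close> removes the cross term in \<open>x\<close> alone; what remains
  carries a factor \<open>norm y\<close> and is absorbed by the loss of norm of \<open>T\<close> on
  \<open>y\<close>. The perturbed norm thus has no first-order term, whereas the value of
  \<open>f\<close> would grow linearly.\<close>

lemma support_vanishes:
  assumes T: "T \<in> ops" "norm T = 1" and E: "finite E" "orthonormal E" "span E = isom T"
    and gap: "gap T (perp (isom T))"
    and f: "f \<in> support T" and A: "A \<in> ops"
    and van: "\<And>x. x \<in> isom T \<Longrightarrow> ip (blinfun_apply T x) (blinfun_apply A x) = 0"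
  shows "f A = 0"
proof (rule ccontr)
  assume "f A \<noteq> 0"
  define \<phi> where "\<phi> = norm (f A)"
  \<comment> \<open>A unimodular factor that rotates \<open>f A\<close> to the positive real number
    \<open>\<phi>\<close>.\<close>
  define c where "c = of_real \<phi> / f A"
  have \<phi>: "\<phi> > 0" using \<open>f A \<noteq> 0\<close> by (simp add: \<phi>_def)
  have c: "norm c = 1" "c * f A = of_real \<phi>"
    using \<open>f A \<noteq> 0\<close> by (auto simp: c_def \<phi>_def norm_divide)
  obtain r where r: "0 \<le> r" "r < 1" "\<And>y. y \<in> perp (isom T) \<Longrightarrow> norm (blinfun_apply T y) \<le> r * norm y"
    using gap by (auto simp: gap_def)
  define B where "B = op_scale c A"
  define a where "a = norm B"
  have a: "a \<ge> 0" by (simp add: a_def)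
  have fd: "f \<in> dual" "f T = 1" "\<And>A. A \<in> ops \<Longrightarrow> norm (f A) \<le> norm A"
    using f by (auto simp: support_def)
  have B: "B \<in> ops" using A by (simp add: B_def op_scale_ops)
  have fB: "f B = of_real \<phi>" using fd A c by (simp add: B_def dual_op_scale)
  have vanB: "ip (blinfun_apply T x) (blinfun_apply B x) = 0" if "x \<in> isom T" for x
    using van[OF that] by (simp add: B_def ip_scale_right)
  define d where "d = 1 - r\<^sup>2"
  have "r\<^sup>2 < 1" using r by (simp add: power_less_one_iff)
  then have d: "d > 0" by (simp add: d_def)
  \<comment> \<open>The first summand accounts for the square of the perturbation, the second for
    completing the square in the cross term.\<close>
  define C where "C = a\<^sup>2 + 4 * a\<^sup>2 / d"
  have C: "C \<ge> 0" using d by (simp add: C_def)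
  have bound: "(norm (blinfun_apply (T + op_scale (of_real e) B) z))\<^sup>2 \<le> (1 + C * e\<^sup>2) * (norm z)\<^sup>2"
    if e: "e > 0" for e z
  proof -
    let ?T = "blinfun_apply T" and ?B = "blinfun_apply B"
    define x y where "x = proj E z" and "y = z - proj E z"
    have x: "x \<in> isom T" using proj_in_span[of E z] E by (simp add: x_def)
    have y: "y \<in> perp (isom T)" using diff_proj_perp[OF E(2,1), of z] perp_span[of E] E by (simp add: y_def)
    have z: "z = x + y" by (simp add: x_def y_def)
    have nz: "(norm z)\<^sup>2 = (norm x)\<^sup>2 + (norm y)\<^sup>2"
      using norm_proj[OF E(2,1), of z] by (simp add: x_def y_def)
    have xz: "norm x \<le> norm z" by (rule power2_le_imp_le) (use nz in auto)
    have Ty: "norm (?T y) \<le> r * norm y" by (rule r(3)[OF y])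
    have By: "norm (?B w) \<le> a * norm w" for w by (simp add: a_def norm_blinfun)
    have "ip (?T x) (?T y) = ip x y" by (rule isom_ip) (use T x in auto)
    also have "\<dots> = 0" using x y by (simp add: perp_def)
    finally have "(norm (?T z))\<^sup>2 = (norm (?T x))\<^sup>2 + (norm (?T y))\<^sup>2"
      unfolding z blinfun.add_right by (rule pythagoras)
    also have "norm (?T x) = norm x" using x by (simp add: isom_def)
    also have "(norm (?T y))\<^sup>2 \<le> (r * norm y)\<^sup>2" using Ty by (simp add: power_mono)
    finally have Tz: "(norm (?T z))\<^sup>2 \<le> (norm z)\<^sup>2 - d * (norm y)\<^sup>2"
      by (simp add: nz d_def power_mult_distrib algebra_simps)
    have "ip (?T z) (?B z) = ip (?T x) (?B y) + ip (?T y) (?B z)"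
      using vanB[OF x] by (simp add: z blinfun.add_right ip_add_left ip_add_right)
    then have "norm (ip (?T z) (?B z)) \<le> norm (?T x) * norm (?B y) + norm (?T y) * norm (?B z)"
      by (metis norm_triangle_mono cauchy_schwarz)
    also have "\<dots> \<le> norm z * (a * norm y) + (1 * norm y) * (a * norm z)"
    proof (intro add_mono mult_mono By)
      show "norm (?T x) \<le> norm z" using x xz by (simp add: isom_def)
      show "norm (?T y) \<le> 1 * norm y" using Ty r(2) mult_right_mono[of r 1 "norm y"] by simp
    qed (use a in auto)
    finally have ip: "norm (ip (?T z) (?B z)) \<le> 2 * a * norm y * norm z" by simp
    have "(norm (?T z + e *\<^sub>R ?B z))\<^sup>2 \<le> (norm (?T z))\<^sup>2 + 2 * norm (ip (?T z) (e *\<^sub>R ?B z)) + (norm (e *\<^sub>R ?B z))\<^sup>2"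
      by (rule norm_add_square_le)
    also have "\<dots> \<le> ((norm z)\<^sup>2 - d * (norm y)\<^sup>2) + 2 * (e * (2 * a * norm y * norm z)) + (e * (a * norm z))\<^sup>2"
    proof -
      have "norm (ip (?T z) (e *\<^sub>R ?B z)) \<le> e * (2 * a * norm y * norm z)"
        using e mult_left_mono[OF ip, of e] by (simp add: ip_scaleR_right)
      moreover have "(norm (e *\<^sub>R ?B z))\<^sup>2 \<le> (e * (a * norm z))\<^sup>2"
        using e By[of z] by (intro power_mono) simp_all
      ultimately show ?thesis using Tz by linarith
    qed
    also have "\<dots> \<le> (norm z)\<^sup>2 + 4 * a\<^sup>2 / d * e\<^sup>2 * (norm z)\<^sup>2 + (e * (a * norm z))\<^sup>2"
    proof -
      \<comment> \<open>Completing the square absorbs the cross term into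
        \<open>d * (norm y)\<^sup>2\<close> at the cost of a term of order
        \<open>e\<^sup>2\<close>.\<close>
      have "0 \<le> (d * norm y - 2 * e * a * norm z)\<^sup>2 / d" using d by simp
      also have "\<dots> = d * (norm y)\<^sup>2 - 2 * (e * (2 * a * norm y * norm z)) + 4 * a\<^sup>2 / d * e\<^sup>2 * (norm z)\<^sup>2"
        using d by (simp add: field_simps power2_eq_square)
      finally show ?thesis by simp
    qed
    also have "\<dots> = (1 + C * e\<^sup>2) * (norm z)\<^sup>2"
      by (simp add: C_def algebra_simps power_mult_distrib)
    finally show ?thesis by (simp add: blinfun.add_left scaleR_eq)
  qed
  have main: "2 * \<phi> \<le> C * e" if e: "e > 0" for e
  proof -
    let ?S = "T + op_scale (of_real e) B"
    have S: "?S \<in> ops" using T B by (simp add: ops_add op_scale_ops)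
    have "norm ?S \<le> sqrt (1 + C * e\<^sup>2)"
    proof (rule norm_blinfun_bound)
      fix z show "norm (blinfun_apply ?S z) \<le> sqrt (1 + C * e\<^sup>2) * norm z"
        using real_sqrt_le_mono[OF bound[OF e, of z]] by (simp add: real_sqrt_mult)
    qed (use C in simp)
    moreover have "norm (f ?S) = 1 + e * \<phi>"
    proof -
      have "f ?S = of_real (1 + e * \<phi>)"
        using fd T B fB by (simp add: dual_add op_scale_ops dual_op_scale)
      then show ?thesis using e \<phi> by (simp only: norm_of_real) simp
    qed
    ultimately have "1 + e * \<phi> \<le> sqrt (1 + C * e\<^sup>2)" using fd(3)[OF S] by linarith
    then have "(1 + e * \<phi>)\<^sup>2 \<le> 1 + C * e\<^sup>2"
      using e \<phi> C by (metis real_sqrt_le_iff real_sqrt_abs abs_of_nonneg add_nonneg_nonneg less_imp_le mult_nonneg_nonneg zero_le_one)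
    then have "e * (2 * \<phi>) + (e * \<phi>)\<^sup>2 \<le> e * (C * e)"
      by (simp add: power2_eq_square algebra_simps)
    then have "e * (2 * \<phi>) \<le> e * (C * e)" by (smt (verit) zero_le_power2)
    then show ?thesis using e by simp
  qed
  \<comment> \<open>Taking \<open>e = \<phi> / (C + 1)\<close> brings the right side down to at most
    \<open>\<phi>\<close>; the added 1 covers \<open>C = 0\<close>.\<close>
  have "2 * \<phi> \<le> C * (\<phi> / (C + 1))" using C \<phi> by (intro main) simp
  also have "\<dots> \<le> \<phi>" using C \<phi> by (simp add: field_simps)
  finally show False using \<phi> by simp
qed

section \<open>Computing the dimension from a biorthogonal family\<close>

definition smooth :: "nat \<Rightarrow> ('a \<Rightarrow>\<^sub>L 'a) \<Rightarrow> bool" where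
  "smooth k T \<longleftrightarrow> (\<exists>B. finite B \<and> card B = k \<and> F.independent B \<and> F.span B = F.span (support T))"

lemma smooth_unique: "smooth k T \<Longrightarrow> smooth l T \<Longrightarrow> k = l"
  unfolding smooth_def by (metis F.dim_span F.dim_eq_card_independent)

text \<open>Subtracting from \<open>A\<close> its expansion along the \<open>a p\<close> leaves an
  operator killed by all \<open>w p\<close>, hence by every support functional. So a support
  functional \<open>f\<close> is the combination of the \<open>w p\<close> with coefficients
  \<open>f (a p)\<close>, and the \<open>w p\<close> form a basis of the span.\<close>

lemma smoothI:
  assumes T: "T \<in> ops" "norm T = 1" and E: "finite E" "orthonormal E" "span E = isom T"
    and gap: "gap T (perp (isom T))"
    and P: "finite P" and biorth: "\<And>p q. p \<in> P \<Longrightarrow> q \<in> P \<Longrightarrow> w p (a q) = (if p = q then 1 else 0)"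
    and w: "\<And>p. p \<in> P \<Longrightarrow> w p \<in> dual" "\<And>p. p \<in> P \<Longrightarrow> w p \<in> F.span (support T)"
    and a: "\<And>p. p \<in> P \<Longrightarrow> a p \<in> ops"
    and van: "\<And>A x. A \<in> ops \<Longrightarrow> (\<And>p. p \<in> P \<Longrightarrow> w p A = 0) \<Longrightarrow> x \<in> isom T \<Longrightarrow>
        ip (blinfun_apply T x) (blinfun_apply A x) = 0"
  shows "smooth (card P) T"
proof -
  have "f \<in> F.span (w ` P)" if f: "f \<in> support T" for f
  proof -
    have fd: "f \<in> dual" using f by (simp add: support_def)
    have "f A = (\<Sum>p\<in>P. fscale (f (a p)) (w p)) A" for A
    proof (cases "A \<in> ops")
      case True
      define A' where "A' = A - (\<Sum>p\<in>P. op_scale (w p A) (a p))"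
      have sumops: "(\<Sum>p\<in>P. op_scale (w p A) (a p)) \<in> ops" by (intro ops_sum op_scale_ops a)
      have A': "A' \<in> ops" using True sumops by (simp add: A'_def ops_diff)
      have g: "g A' = g A - (\<Sum>p\<in>P. w p A * g (a p))" if "g \<in> dual" for g
        using that True sumops a by (simp add: A'_def dual_diff dual_sum op_scale_ops dual_op_scale)
      have "w q A' = 0" if q: "q \<in> P" for q
      proof -
        have "(\<Sum>p\<in>P. w p A * w q (a p)) = (\<Sum>p\<in>P. if p = q then w q A else 0)"
          by (intro sum.cong) (auto simp: biorth q)
        then show ?thesis using g[OF w(1)[OF q]] q P by simp
      qed
      then have "f A' = 0"
        by (intro support_vanishes[OF T E gap f A'] van[OF A'])
      then show ?thesis using g[OF fd] by (simp add: sum_fun_apply fscale_def mult.commute)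
    next
      case False
      then show ?thesis using fd w(1) by (simp add: sum_fun_apply fscale_def dual_off)
    qed
    then have "f = (\<Sum>p\<in>P. fscale (f (a p)) (w p))" by blast
    also have "\<dots> \<in> F.span (w ` P)" by (intro F.span_sum F.span_scale F.span_base imageI)
    finally show ?thesis .
  qed
  then have "F.span (w ` P) = F.span (support T)"
    using w(2) by (intro antisym F.span_minimal F.subspace_span) auto
  moreover have "F.independent (w ` P)" "card (w ` P) = card P"
    using biorthogonal_independent[where w = w and a = a and I = P] P biorth
    by (auto intro: card_image)
  ultimately show ?thesis unfolding smooth_def using P by (intro exI[of _ "w ` P"]) simp
qed

lemma isom_vf_support:
  assumes "T \<in> ops" "norm T = 1" "x \<in> isom T" "norm x = 1"
  shows "vf T x x \<in> support T"
  using assms by (intro vf_support) (auto simp: isom_def)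

text \<open>Polarization: orthogonality makes \<open>z = (x + c y) / sqrt 2\<close> a unit vector of
  \<open>isom T\<close>, and subtracting the two diagonal functionals from twice the one at
  \<open>z\<close> leaves the mixed terms.\<close>

lemma cross_in_span:
  assumes T: "T \<in> ops" "norm T = 1" and xy: "x \<in> isom T" "y \<in> isom T" "norm x = 1" "norm y = 1" "ip x y = 0"
    and c: "norm c = 1"
  shows "fscale c (vf T x y) + fscale (cn c) (vf T y x) \<in> F.span (support T)"
proof -
  define z where "z = scale (of_real (1 / sqrt 2)) (x + scale c y)"
  have z: "z \<in> isom T"
    using subspace_isom[of T] T xy unfolding z_def by (intro subspace_scale subspace_add) auto
  have "(norm (x + scale c y))\<^sup>2 = 2"
    using pythagoras[of x "scale c y"] xy c by (simp add: ip_scale_right norm_scale)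
  then have "norm (x + scale c y) = sqrt 2" by (metis norm_ge_zero real_sqrt_unique)
  then have nz: "norm z = 1" by (simp add: z_def norm_scale norm_divide)
  have cc: "c * cn c = 1" using cn_mult_self[of c] c by (simp add: mult.commute)
  have half: "(of_real (1 / sqrt 2) :: 'k) * of_real (1 / sqrt 2) = of_real (1 / 2)"
    unfolding of_real_mult[symmetric] by simp
  have "fscale c (vf T x y) + fscale (cn c) (vf T y x)
      = fscale 2 (vf T z z) - vf T x x - vf T y y"
  proof (rule ext)
    fix A
    show "(fscale c (vf T x y) + fscale (cn c) (vf T y x)) A = (fscale 2 (vf T z z) - vf T x x - vf T y y) A"
    proof (cases "A \<in> ops")
      case True
      let ?T = "blinfun_apply T" and ?A = "blinfun_apply A"
      have "vf T z z A = of_real (1 / 2) * (ip (?T x) (?A x) + c * ip (?T x) (?A y) + cn c * ip (?T y) (?A x)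
          + c * cn c * ip (?T y) (?A y))"
        unfolding half[symmetric] using True
        by (simp only: vf_def z_def opsD[OF True] opsD[OF T(1)] ip_scale_left ip_scale_right
            ip_add_left ip_add_right blinfun.add_right cn_of_real if_True)
           (simp add: algebra_simps)
      then have "2 * vf T z z A = vf T x x A + c * vf T x y A + cn c * vf T y x A + vf T y y A"
        using True cc by (simp add: vf_def mult.commute[of "2::'k"])
      then show ?thesis by (simp add: fscale_def)
    qed (simp add: fscale_def vf_def)
  qed
  also have "\<dots> \<in> F.span (support T)"
    using z nz T xy by (intro F.span_diff F.span_scale F.span_base isom_vf_support)
  finally show ?thesis .
qed

section \<open>The span of the support functionals\<close>

lemma orthonormal_enum:
  assumes "finite E" "orthonormal E"
  obtains e where "e ` {..<card E} = E"
    "\<And>i j. i < card E \<Longrightarrow> j < card E \<Longrightarrow> ip (e i) (e j) = (if i = j then 1 else 0)"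
proof -
  obtain e where e: "bij_betw e {..<card E} E"
    using ex_bij_betw_nat_finite[OF assms(1)] by (auto simp: atLeast0LessThan)
  have "ip (e i) (e j) = (if i = j then 1 else 0)" if "i < card E" "j < card E" for i j
    using that assms(2) e unfolding orthonormal_def bij_betw_def inj_on_def
    by (metis imageI lessThan_iff)
  then show thesis using that e by (auto simp: bij_betw_def)
qed

text \<open>\<open>\<iota>\<close> stands for the imaginary unit. Polarizing with both 1 and
  \<open>\<iota>\<close> separates the two mixed functionals, so every ordered pair of basis vectors
  contributes one dimension.\<close>

lemma smooth_hermitian:
  assumes imag: "cn \<iota> = - \<iota>" "norm \<iota> = 1"
    and T: "T \<in> ops" "norm T = 1" and E: "finite E" "orthonormal E" "span E = isom T"
    and gap: "gap T (perp (isom T))"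
  shows "smooth ((card E)\<^sup>2) T"
proof -
  let ?T = "blinfun_apply T"
  obtain e where e: "e ` {..<card E} = E"
    "\<And>i j. i < card E \<Longrightarrow> j < card E \<Longrightarrow> ip (e i) (e j) = (if i = j then 1 else 0)"
    using orthonormal_enum[OF E(1,2)] by blast
  have eE: "e i \<in> E" "e i \<in> isom T" "norm (e i) = 1" if "i < card E" for i
    using e(1) that E span_base[of "e i" E] orthonormal_norm[OF E(2)] by auto
  have ipT: "ip (?T (e i)) (?T (e j)) = (if i = j then 1 else 0)" if "i < card E" "j < card E" for i j
    using isom_ip[OF T(1) _ eE(2)[OF that(1)], of "e j"] T e(2) that by simp
  have "smooth (card ({..<card E} \<times> {..<card E})) T"
  proof (rule smoothI[OF T E gap, where w = "\<lambda>(i, j). vf T (e i) (e j)" and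
        a = "\<lambda>(i, j). rank_one (?T (e i)) (e j)"])
    fix p q assume "p \<in> {..<card E} \<times> {..<card E}" "q \<in> {..<card E} \<times> {..<card E}"
    then show "(case p of (i, j) \<Rightarrow> vf T (e i) (e j)) (case q of (i, j) \<Rightarrow> rank_one (?T (e i)) (e j))
        = (if p = q then 1 else 0)"
      by (auto simp: vf_def rank_one_ops ip_scale_right ipT e(2) split: if_splits)
  next
    fix p assume "p \<in> {..<card E} \<times> {..<card E}"
    then obtain i j where p: "p = (i, j)" "i < card E" "j < card E" by auto
    show "(case p of (i, j) \<Rightarrow> vf T (e i) (e j)) \<in> F.span (support T)"
    proof (cases "i = j")
      case True
      then show ?thesis using p eE T by (auto intro!: F.span_base isom_vf_support)
    next
      case False
      define u v where "u = vf T (e i) (e j)" and "v = vf T (e j) (e i)"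
      have span: "fscale c u + fscale (cn c) v \<in> F.span (support T)" if "norm c = 1" for c
        unfolding u_def v_def using False p eE e(2) T that by (intro cross_in_span) auto
      have "\<iota> \<noteq> 0" using imag(2) by auto
      \<comment> \<open>The two combinations are \<open>u + v\<close> and \<open>\<iota>\<close>
        times \<open>u - v\<close>, because \<open>cn \<iota> = - \<iota>\<close>.\<close>
      have "u = fscale (1 / 2) ((fscale 1 u + fscale (cn 1) v) + fscale (1 / \<iota>) (fscale \<iota> u + fscale (cn \<iota>) v))"
        using \<open>\<iota> \<noteq> 0\<close> by (simp add: fun_eq_iff fscale_def imag(1) cn_1 field_simps)
      also have "\<dots> \<in> F.span (support T)"
        using imag(2) by (intro F.span_scale F.span_add span) auto
      finally show ?thesis by (simp add: p u_def)
    qed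
  next
    fix A x assume A: "A \<in> ops" and x: "x \<in> isom T"
      and w0: "\<And>p. p \<in> {..<card E} \<times> {..<card E} \<Longrightarrow> (case p of (i, j) \<Rightarrow> vf T (e i) (e j)) A = 0"
    \<comment> \<open>The mixed form vanishes on pairs of basis vectors, then on the span by
      linearity in one argument at a time.\<close>
    have 0: "ip (?T u) (blinfun_apply A v) = 0" if "u \<in> E" "v \<in> E" for u v
    proof -
      have "u \<in> e ` {..<card E}" "v \<in> e ` {..<card E}" using that by (simp_all add: e(1))
      then obtain i j where "i < card E" "j < card E" "u = e i" "v = e j" by blast
      then show ?thesis using w0[of "(i, j)"] A by (simp add: vf_def)
    qed
    have 1: "ip (?T u) (blinfun_apply A v) = 0" if "u \<in> E" "v \<in> span E" for u v
      using that(2) by (induction rule: span_induct_alt)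
        (auto simp: blinfun.add_right ip_add_right opsD[OF A] ip_scale_right 0 that(1))
    have "ip (?T u) (blinfun_apply A v) = 0" if "u \<in> span E" "v \<in> span E" for u v
      using that(1) by (induction rule: span_induct_alt)
        (auto simp: blinfun.add_right ip_add_left opsD[OF T(1)] ip_scale_left 1 that(2))
    then show "ip (?T x) (blinfun_apply A x) = 0" using x E(3) by simp
  qed (auto simp: vf_dual rank_one_ops)
  then show ?thesis by (simp add: power2_eq_square)
qed

text \<open>With trivial conjugation polarization yields only the symmetric sums of mixed
  functionals, so the dimension counts unordered pairs, repetitions included.\<close>

lemma smooth_symmetric:
  assumes real: "\<And>c. cn c = c"
    and T: "T \<in> ops" "norm T = 1" and E: "finite E" "orthonormal E" "span E = isom T"
    and gap: "gap T (perp (isom T))"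
  shows "smooth ((card E + 1) choose 2) T"
proof -
  let ?T = "blinfun_apply T"
  define n where "n = card E"
  obtain e where e: "e ` {..<n} = E"
    "\<And>i j. i < n \<Longrightarrow> j < n \<Longrightarrow> ip (e i) (e j) = (if i = j then 1 else 0)"
    using orthonormal_enum[OF E(1,2)] unfolding n_def by blast
  have eE: "e i \<in> E" "e i \<in> isom T" "norm (e i) = 1" if "i < n" for i
    using e(1) that E span_base[of "e i" E] orthonormal_norm[OF E(2)] by auto
  have ipT: "ip (?T (e i)) (?T (e j)) = (if i = j then 1 else 0)" if "i < n" "j < n" for i j
    using isom_ip[OF T(1) _ eE(2)[OF that(1)], of "e j"] T e(2) that by simp
  \<comment> \<open>The order \<open>i \<le> j\<close> picks one representative per unordered pair.
    It also makes the swapped summand of an off-diagonal \<open>w p\<close> vanish on every chosen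
    rank-one operator.\<close>
  define P where "P = (SIGMA j:{..<n}. {..j})"
  define w where "w = (\<lambda>(j, i). if i = j then vf T (e i) (e i) else vf T (e i) (e j) + vf T (e j) (e i))"
  have "smooth (card P) T"
  proof (rule smoothI[OF T E gap, where w = w and a = "\<lambda>(j, i). rank_one (?T (e i)) (e j)"])
    fix p q assume "p \<in> P" "q \<in> P"
    then show "w p (case q of (j, i) \<Rightarrow> rank_one (?T (e i)) (e j)) = (if p = q then 1 else 0)"
      by (auto simp: P_def w_def vf_def rank_one_ops ip_scale_right ipT e(2) split: if_splits)
  next
    fix p assume "p \<in> P"
    then obtain i j where p: "p = (j, i)" "i < n" "j < n" by (auto simp: P_def)
    show "w p \<in> dual"
      by (auto simp: p w_def dual_def vf_def ops_add op_scale_ops blinfun.add_left ip_add_right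
          ip_scale_right distrib_left)
    show "w p \<in> F.span (support T)"
    proof (cases "i = j")
      case True
      then show ?thesis using p eE T by (auto simp: w_def intro!: F.span_base isom_vf_support)
    next
      case False
      then have "fscale 1 (vf T (e i) (e j)) + fscale (cn 1) (vf T (e j) (e i)) \<in> F.span (support T)"
        using p eE e(2) T by (intro cross_in_span) auto
      then show ?thesis using False by (simp add: p w_def cn_1)
    qed
  next
    fix A x assume A: "A \<in> ops" and x: "x \<in> isom T" and w0: "\<And>p. p \<in> P \<Longrightarrow> w p A = 0"
    \<comment> \<open>Only the symmetrized form is controlled by the \<open>w p\<close>; its value
      at \<open>x\<close>, \<open>x\<close> is twice the number in question.\<close>
    define \<beta> where "\<beta> = (\<lambda>u v. ip (?T u) (blinfun_apply A v) + ip (?T v) (blinfun_apply A u))"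
    have \<beta>_sym: "\<beta> u v = \<beta> v u" for u v by (simp add: \<beta>_def add.commute)
    have \<beta>_le: "\<beta> (e i) (e j) = 0" if "i \<le> j" "j < n" for i j
      using w0[of "(j, i)"] that A by (auto simp: P_def w_def vf_def \<beta>_def split: if_splits)
    have 0: "\<beta> u v = 0" if "u \<in> E" "v \<in> E" for u v
    proof -
      have "u \<in> e ` {..<n}" "v \<in> e ` {..<n}" using that by (simp_all add: e(1))
      then obtain i j where "i < n" "j < n" "u = e i" "v = e j" by blast
      then show ?thesis using \<beta>_le[of i j] \<beta>_le[of j i] \<beta>_sym by (metis nat_le_linear)
    qed
    have add: "\<beta> u (v + v') = \<beta> u v + \<beta> u v'" and scale: "\<beta> u (scale c v) = c * \<beta> u v" for u v v' c
      by (auto simp: \<beta>_def blinfun.add_right ip_add_right ip_add_left opsD[OF A] opsD[OF T(1)]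
          ip_scale_left ip_scale_right real distrib_left)
    have \<beta>_0: "\<beta> u 0 = 0" for u using scale[of u 0 0] by simp
    have 1: "\<beta> u v = 0" if "u \<in> E" "v \<in> span E" for u v
      using that(2) by (induction rule: span_induct_alt) (auto simp: \<beta>_0 add scale 0 that(1))
    have "\<beta> u v = 0" if "u \<in> span E" "v \<in> span E" for u v
      using that(2) by (induction rule: span_induct_alt) (auto simp: \<beta>_0 add scale \<beta>_sym[of u] 1 that(1))
    from this[of x x] show "ip (?T x) (blinfun_apply A x) = 0"
      using x E(3) by (simp add: \<beta>_def flip: mult_2)
  qed (auto simp: rank_one_ops P_def)
  moreover have "card P = (n + 1) choose 2"
  proof -
    have "card P = (\<Sum>j<n. Suc j)" by (simp add: P_def)
    also have "\<dots> = (n + 1) choose 2" by (induction n) (auto simp: numeral_2_eq_2)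
    finally show ?thesis .
  qed
  ultimately show ?thesis by (simp add: n_def)
qed

text \<open>Linearity and the bound by \<open>norm A\<close> survive pointwise limits, and the
  values at \<open>T\<close> are the squares of \<open>norm (T (y m))\<close>, which tend to 1. The
  filter is returned as well, so that \<open>f\<close> can be evaluated at particular operators
  later.\<close>

lemma cluster_support:
  assumes T: "T \<in> ops" "norm T = 1" and y: "\<And>m. norm (y m) = 1"
    and lim: "(\<lambda>m. norm (blinfun_apply T (y m))) \<longlonglongrightarrow> 1"
  obtains F f where "F \<noteq> bot" "f \<in> support T" "F \<le> sequentially"
    "\<And>A. ((\<lambda>m. vf T (y m) (y m) A) \<longlongrightarrow> f A) F"
proof -
  have le: "norm (vf T (y m) (y m) A) \<le> norm A" for m A
    using T y by (intro norm_vf_le) auto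
  obtain F f where F: "F \<noteq> bot" "F \<le> sequentially" "\<And>A. ((\<lambda>m. vf T (y m) (y m) A) \<longlongrightarrow> f A) F"
    using bounded_functions_cluster[of "\<lambda>m. vf T (y m) (y m)" norm] le by blast
  note uniq = tendsto_unique[OF F(1) F(3)]
  have "f \<in> dual"
    unfolding dual_def
  proof (intro CollectI conjI ballI allI impI)
    fix A B assume "A \<in> ops" "B \<in> ops"
    then show "f (A + B) = f A + f B"
      using tendsto_add[OF F(3)[of A] F(3)[of B]]
      by (intro uniq) (simp add: dual_add[OF vf_dual])
  next
    fix A c assume "A \<in> ops"
    then show "f (op_scale c A) = c * f A"
      using tendsto_mult_left[OF F(3)[of A], of c]
      by (intro uniq) (simp add: dual_op_scale[OF vf_dual])
  next
    fix A assume "A \<notin> ops"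
    then show "f A = 0" by (intro uniq) (simp add: vf_def)
  qed
  moreover have "norm (f A) \<le> norm A" for A
    using tendsto_upperbound[OF tendsto_norm[OF F(3)[of A]] _ F(1), of "norm A"] le by simp
  moreover have "f T = 1"
  proof (rule uniq)
    have "(\<lambda>m. of_real ((norm (blinfun_apply T (y m)))\<^sup>2) :: 'k) \<longlonglongrightarrow> of_real (1\<^sup>2)"
      by (intro tendsto_intros lim)
    then show "((\<lambda>m. vf T (y m) (y m) T) \<longlongrightarrow> 1) F"
      using F(2) T(1) by (simp add: vf_def ip_self tendsto_mono)
  qed
  ultimately have "f \<in> support T" by (simp add: support_def)
  then show thesis using that F by blast
qed

section \<open>Orthonormal sequences and their projections\<close>

lemma orthonormal_sequence_sum:
  fixes x :: "nat \<Rightarrow> 'a"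
  assumes x: "\<And>i j. ip (x i) (x j) = (if i = j then 1 else 0)" and "finite I"
  shows "(norm (\<Sum>i\<in>I. scale (c i) (x i)))\<^sup>2 = (\<Sum>i\<in>I. (norm (c i))\<^sup>2)"
  using assms(2)
proof (induction I rule: finite_induct)
  case (insert j I)
  have nx: "norm (x j) = 1"
    by (rule norm_eq_1) (simp add: x)
  have "ip (scale (c j) (x j)) (\<Sum>i\<in>I. scale (c i) (x i)) = 0"
    unfolding ip_sum_right using insert.hyps(2)
    by (intro sum.neutral) (auto simp: ip_scale_left ip_scale_right x)
  from pythagoras[OF this] show ?case
    using insert nx by (simp add: norm_scale)
qed simp

lemma orthonormal_sequence_bessel:
  fixes x :: "nat \<Rightarrow> 'a"
  assumes x: "\<And>i j. ip (x i) (x j) = (if i = j then 1 else 0)" and "finite I"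
  shows "(\<Sum>i\<in>I. (norm (ip (x i) z))\<^sup>2) \<le> (norm z)\<^sup>2"
proof -
  have inj: "inj_on x I" by (intro inj_onI) (metis x zero_neq_one)
  have on: "orthonormal (x ` I)" using x by (auto simp: orthonormal_def) (metis x zero_neq_one)
  have "proj (x ` I) z = (\<Sum>i\<in>I. scale (ip (x i) z) (x i))"
    by (simp add: proj_def sum.reindex[OF inj])
  then show ?thesis
    using norm_proj[OF on, of z] orthonormal_sequence_sum[OF x \<open>finite I\<close>, of "\<lambda>i. ip (x i) z"] \<open>finite I\<close>
    by simp
qed

text \<open>\<open>Q\<close> is the orthogonal projection onto the closed span of the
  \<open>x i\<close> with \<open>i \<in> S\<close>, written as a series. Bessel's inequality makes
  the partial sums Cauchy, and completeness gives the limit.\<close>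

lemma sequence_projection:
  fixes x :: "nat \<Rightarrow> 'a"
  assumes x: "\<And>i j. ip (x i) (x j) = (if i = j then 1 else 0)"
  obtains Q where "Q \<in> ops" "\<And>i. blinfun_apply Q (x i) = (if i \<in> S then x i else 0)"
proof -
  \<comment> \<open>Zero coefficients off \<open>S\<close> let the series run over all natural
    numbers.\<close>
  define c where "c = (\<lambda>z i. if i \<in> S then ip (x i) z else 0)"
  define a where "a = (\<lambda>z i. scale (c z i) (x i))"
  have bessel: "(\<Sum>i\<in>I. (norm (c z i))\<^sup>2) \<le> (norm z)\<^sup>2" if "finite I" for I z
  proof -
    have "(\<Sum>i\<in>I. (norm (c z i))\<^sup>2) \<le> (\<Sum>i\<in>I. (norm (ip (x i) z))\<^sup>2)"
      by (intro sum_mono) (simp add: c_def)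
    then show ?thesis using orthonormal_sequence_bessel[OF x that, of z] by linarith
  qed
  have norm_a: "(norm (\<Sum>i\<in>I. a z i))\<^sup>2 = (\<Sum>i\<in>I. (norm (c z i))\<^sup>2)" if "finite I" for I z
    unfolding a_def by (rule orthonormal_sequence_sum[OF x that])
  have summ: "summable (a z)" for z
  proof -
    have c2: "summable (\<lambda>i. (norm (c z i))\<^sup>2)"
      using bessel by (intro summableI_nonneg_bounded[where x = "(norm z)\<^sup>2"]) auto
    have "Cauchy (\<lambda>n. sum (a z) {..<n})"
    proof (rule CauchyI')
      fix e :: real assume "e > 0"
      then obtain N where N: "\<And>m n. m \<ge> N \<Longrightarrow> norm (\<Sum>i=m..<n. (norm (c z i))\<^sup>2) < e\<^sup>2"
        using c2 unfolding summable_Cauchy by (meson zero_less_power)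
      have "dist (sum (a z) {..<m}) (sum (a z) {..<n}) < e" if "m \<ge> N" "m < n" for m n
      proof -
        have "sum (a z) {m..<n} = sum (a z) {..<n} - sum (a z) {..<m}"
          using that(2) by (subst sum_diff[symmetric]) auto
        moreover have "norm (sum (a z) {m..<n}) < e"
        proof (rule power_less_imp_less_base)
          show "(norm (sum (a z) {m..<n}))\<^sup>2 < e\<^sup>2"
            using N[OF that(1), of n] by (simp add: norm_a sum_nonneg)
        qed (use \<open>e > 0\<close> in simp)
        ultimately show ?thesis by (simp add: dist_norm norm_minus_commute)
      qed
      then show "\<exists>N. \<forall>m\<ge>N. \<forall>n>m. dist (sum (a z) {..<m}) (sum (a z) {..<n}) < e" by blast
    qed
    then show ?thesis by (simp add: summable_iff_convergent Cauchy_convergent)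
  qed
  define q where "q = (\<lambda>z. suminf (a z))"
  have scale: "q (scale d z) = scale d (q z)" for d z
  proof -
    have "a (scale d z) = (\<lambda>i. scale d (a z i))"
      by (auto simp: a_def c_def ip_scale_right)
    then show ?thesis
      unfolding q_def using bounded_linear.suminf[OF bounded_linear_scale summ, of d z] by simp
  qed
  have lin: "bounded_linear q"
  proof (rule bounded_linear_intro[of _ 1])
    fix z z'
    have "a (z + z') = (\<lambda>i. a z i + a z' i)"
      by (auto simp: a_def c_def ip_add_right scale_left_distrib)
    then show "q (z + z') = q z + q z'"
      unfolding q_def using suminf_add[OF summ summ, of z z'] by simp
  next
    fix r z show "q (r *\<^sub>R z) = r *\<^sub>R q z" by (simp add: scaleR_eq scale)
  next
    fix z
    have "norm (sum (a z) {..<n}) \<le> norm z" for n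
      by (rule power2_le_imp_le) (use norm_a[of "{..<n}" z] bessel[of "{..<n}" z] in auto)
    then have "norm (q z) \<le> norm z"
      unfolding q_def using tendsto_norm[OF summable_LIMSEQ[OF summ[of z]]]
      by (intro LIMSEQ_le_const2) auto
    then show "norm (q z) \<le> norm z * 1" by simp
  qed
  have "q (x i) = (if i \<in> S then x i else 0)" for i
  proof -
    have "a (x i) j = 0" if "j \<notin> {i}" for j using that by (auto simp: a_def c_def x)
    from suminf_finite[of "{i}" "a (x i)", OF _ this] have "q (x i) = a (x i) i"
      by (simp add: q_def)
    then show ?thesis by (simp add: a_def c_def x)
  qed
  then show thesis
    using lin scale by (intro that[of "Blinfun q"]) (auto simp: ops_def bounded_linear_Blinfun_apply)
qed

text \<open>Functionals obtained as limits along disjoint subsequences are separated by \<open>T\<close> composed with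
  the projections onto the spans of these subsequences.\<close>

lemma no_orthonormal_maximizing_sequence:
  fixes x :: "nat \<Rightarrow> 'a"
  assumes T: "T \<in> ops" "norm T = 1" and S: "finite S" "support T \<subseteq> F.span S"
    and x: "\<And>i j. ip (x i) (x j) = (if i = j then 1 else 0)"
    and lim: "(\<lambda>m. norm (blinfun_apply T (x m))) \<longlonglongrightarrow> 1"
  shows False
proof -
  let ?T = "blinfun_apply T"
  \<comment> \<open>The residue classes modulo \<open>N\<close> give \<open>N\<close> independent
    support functionals, one more than \<open>S\<close> can span.\<close>
  define N where "N = Suc (card S)"
  define y where "y = (\<lambda>j m. x (m * N + j))"
  have nx: "norm (x m) = 1" for m
    by (rule norm_eq_1) (simp add: x)
  have "strict_mono (\<lambda>m. m * N + j)" for j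
    by (intro strict_monoI add_strict_right_mono mult_strict_right_mono) (simp_all add: N_def)
  from LIMSEQ_subseq_LIMSEQ[OF lim this]
  have ylim: "(\<lambda>m. norm (?T (y j m))) \<longlonglongrightarrow> 1" for j
    by (simp add: y_def o_def)
  have "\<exists>f\<in>support T. \<exists>F. F \<noteq> bot \<and> F \<le> sequentially \<and> (\<forall>A. ((\<lambda>m. vf T (y j m) (y j m) A) \<longlongrightarrow> f A) F)" for j
  proof -
    have "norm (y j m) = 1" for m by (simp add: y_def nx)
    from cluster_support[OF T this ylim] show ?thesis by blast
  qed
  then obtain f where f: "\<And>j. f j \<in> support T" and
    "\<And>j. \<exists>F. F \<noteq> bot \<and> F \<le> sequentially \<and> (\<forall>A. ((\<lambda>m. vf T (y j m) (y j m) A) \<longlongrightarrow> f j A) F)"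
    by metis
  then obtain F where F: "\<And>j. F j \<noteq> bot" "\<And>j. F j \<le> sequentially"
    "\<And>j A. ((\<lambda>m. vf T (y j m) (y j m) A) \<longlongrightarrow> f j A) (F j)"
    by metis
  have "\<exists>Q\<in>ops. \<forall>i. blinfun_apply Q (x i) = (if i \<in> {i. i mod N = j} then x i else 0)" for j
    using sequence_projection[OF x, of "{i. i mod N = j}"] by metis
  then obtain Q where Q: "\<And>j. Q j \<in> ops"
    "\<And>i j. blinfun_apply (Q j) (x i) = (if i mod N = j then x i else 0)"
    by simp metis
  define A where "A = (\<lambda>j. T o\<^sub>L Q j)"
  have A: "A j \<in> ops" for j using Q(1)[of j] T(1) by (simp add: A_def ops_def)
  have biorth: "f i (A j) = (if i = j then 1 else 0)" if "i < N" "j < N" for i j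
  proof (rule tendsto_unique[OF F(1) F(3)])
    have 1: "vf T (y i m) (y i m) (A j) = of_real (if i = j then (norm (?T (y i m)))\<^sup>2 else 0)" for m
      using that A[of j] by (simp add: vf_def A_def Q(2) y_def ip_self)
    have "(\<lambda>m. of_real (if i = j then (norm (?T (y i m)))\<^sup>2 else 0) :: 'k) \<longlonglongrightarrow> of_real (if i = j then 1\<^sup>2 else 0)"
      by (cases "i = j") (auto intro!: tendsto_intros ylim simp del: power_one of_real_power)
    then have "(\<lambda>m. vf T (y i m) (y i m) (A j)) \<longlonglongrightarrow> (if i = j then 1 else 0)"
      unfolding 1 by (cases "i = j") auto
    then show "((\<lambda>m. vf T (y i m) (y i m) (A j)) \<longlongrightarrow> (if i = j then 1 else 0)) (F i)"
      by (rule tendsto_mono[OF F(2)])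
  qed
  have "card {..<N} \<le> card S"
    using biorth f S by (intro biorthogonal_card_le[where w = f and a = A]) auto
  then show False by (simp add: N_def)
qed

text \<open>\<open>T\<close> maps an orthonormal subset of \<open>isom T\<close> to an orthonormal
  set, so rank-one operators separate the support functionals \<open>vf T e e\<close>. This bounds
  the dimension of \<open>isom T\<close>.\<close>

lemma isom_orthonormal_card:
  assumes T: "T \<in> ops" "norm T = 1" and S: "finite S" "support T \<subseteq> F.span S"
    and E: "E \<subseteq> isom T" "finite E" "orthonormal E"
  shows "card E \<le> card S"
proof (rule biorthogonal_card_le[where w = "\<lambda>e. vf T e e" and a = "\<lambda>e. rank_one (blinfun_apply T e) e"])
  show "vf T d d (rank_one (blinfun_apply T e) e) = (if d = e then 1 else 0)" if "d \<in> E" "e \<in> E" for d e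
  proof -
    have "ip (blinfun_apply T d) (blinfun_apply T e) = ip d e"
      using that E T by (intro isom_ip) auto
    then show ?thesis
      using that E(3) by (auto simp: vf_def rank_one_ops ip_scale_right orthonormal_def split: if_splits)
  qed
  show "(\<lambda>e. vf T e e) ` E \<subseteq> F.span S"
    using isom_vf_support[OF T] E orthonormal_norm[OF E(3)] S(2) by blast
qed (use S E in auto)

lemma tendsto_one_of_gt:
  assumes "\<And>m. f m > 1 - inverse (real (Suc m))" "\<And>m. f m \<le> 1"
  shows "f \<longlonglongrightarrow> 1"
proof (rule tendsto_sandwich)
  show "(\<lambda>m. 1 + - inverse (real (Suc m))) \<longlonglongrightarrow> 1"
    by (rule LIMSEQ_inverse_real_of_nat_add_minus)
  show "\<forall>\<^sub>F m in sequentially. 1 + - inverse (real (Suc m)) \<le> f m"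
    using assms(1) by (intro always_eventually allI) (simp add: less_imp_le)
qed (use assms(2) in auto)

text \<open>If no finite \<open>G\<close> worked, unit vectors nearly attaining the norm could be
  chosen one after another, each orthogonal to its predecessors, giving the orthonormal maximizing
  sequence already excluded.\<close>

lemma finite_codimensional_gap:
  assumes T: "T \<in> ops" "norm T = 1" and S: "finite S" "support T \<subseteq> F.span S"
  obtains G where "finite G" "orthonormal G" "gap T (perp G)"
proof (rule ccontr)
  assume "\<not> thesis"
  with that have no: "\<not> gap T (perp G)" if "finite G" "orthonormal G" for G
    using \<open>finite G\<close> \<open>orthonormal G\<close> by blast
  define P where "P = (\<lambda>f m r. r \<in> perp (f ` {..<m}) \<and> norm r = 1 \<and>
      norm (blinfun_apply T r) > 1 - inverse (real (Suc m)))"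
  have "\<exists>x. \<forall>m. P x m (x m)"
  proof (rule dependent_wellorder_choice)
    show "P f m r = P g m r" if "\<And>i. i < m \<Longrightarrow> f i = g i" for r f g m
    proof -
      have "f ` {..<m} = g ` {..<m}" using that by (intro image_cong) auto
      then show ?thesis by (simp add: P_def)
    qed
    show "\<exists>r. P f m r" if prev: "\<And>i. i < m \<Longrightarrow> P f i (f i)" for m f
    proof -
      have "orthonormal (f ` {..<j})" if "j \<le> m" for j
        using that
      proof (induction j)
        case (Suc j)
        then show ?case
          using prev[of j] orthonormal_insert[of "f ` {..<j}" "f j"] by (simp add: P_def lessThan_Suc)
      qed (simp add: orthonormal_def)
      then have "orthonormal (f ` {..<m})" by simp
      then have "\<not> gap T (perp (f ` {..<m}))" by (intro no) auto
      from not_gapE[OF subspace_perp this, of "inverse (real (Suc m))"] show ?thesis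
        unfolding P_def by (metis inverse_positive_iff_positive of_nat_0_less_iff zero_less_Suc)
    qed
  qed
  then obtain x where x: "\<And>m. P x m (x m)" by blast
  have less: "ip (x i) (x j) = 0" if "i < j" for i j
    using x[of j] that by (simp add: P_def perp_def)
  have ip: "ip (x i) (x j) = (if i = j then 1 else 0)" for i j
    using less[of i j] less[of j i] ip_eq_0_sym[of "x i" "x j"] x[of j]
    by (cases i j rule: linorder_cases) (auto simp: P_def ip_self)
  have "(\<lambda>m. norm (blinfun_apply T (x m))) \<longlonglongrightarrow> 1"
  proof (rule tendsto_one_of_gt)
    show "norm (blinfun_apply T (x m)) \<le> 1" for m
      using norm_apply_le[of T "x m"] T x[of m] by (simp add: P_def)
  qed (use x in \<open>auto simp: P_def\<close>)
  from no_orthonormal_maximizing_sequence[OF T S ip this] show False .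
qed

text \<open>The form \<open>q\<close> is coercive on a subspace of finite codimension, so a bounded sequence on which
  \<open>q\<close> tends to 0 has a convergent subsequence.\<close>

lemma gap_perp_isom:
  assumes T: "T \<in> ops" "norm T \<le> 1" and G: "finite G" "orthonormal G" "gap T (perp G)"
  shows "gap T (perp (isom T))"
proof (rule ccontr)
  let ?T = "blinfun_apply T"
  assume no: "\<not> gap T (perp (isom T))"
  have "\<exists>x. x \<in> perp (isom T) \<and> norm x = 1 \<and> norm (?T x) > 1 - inverse (real (Suc m))" for m
    using not_gapE[OF subspace_perp no, of "inverse (real (Suc m))"]
    by (metis inverse_positive_iff_positive of_nat_0_less_iff zero_less_Suc)
  then obtain x where x: "\<And>m. x m \<in> perp (isom T)" "\<And>m. norm (x m) = 1"
    "\<And>m. norm (?T (x m)) > 1 - inverse (real (Suc m))"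
    by metis
  have xlim: "(\<lambda>m. norm (?T (x m))) \<longlonglongrightarrow> 1"
    using norm_apply_le[OF T(2)] by (intro tendsto_one_of_gt x(3)) (metis x(2))
  have "norm (ip e (x m)) \<le> norm e" for e m using cauchy_schwarz[of e "x m"] by (simp add: x)
  with convergent_subsequence_finite[OF G(1), of "\<lambda>e m. ip e (x m)" norm]
  obtain s where s: "strict_mono s" "\<And>e. e \<in> G \<Longrightarrow> convergent (\<lambda>m. ip e (x (s m)))" by auto
  define y where "y = (\<lambda>m. x (s m))"
  \<comment> \<open>\<open>u\<close> converges because its finitely many coefficients do;
    \<open>v\<close> stays in \<open>perp G\<close>, where \<open>q\<close> is coercive.\<close>
  define u where "u = (\<lambda>m. proj G (y m))"
  define v where "v = (\<lambda>m. y m - u m)"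
  have y: "\<And>m. y m \<in> perp (isom T)" "\<And>m. norm (y m) = 1" by (auto simp: y_def x)
  have ylim: "(\<lambda>m. norm (?T (y m))) \<longlonglongrightarrow> 1"
    using LIMSEQ_subseq_LIMSEQ[OF xlim s(1)] by (simp add: y_def o_def)
  have "\<exists>l. (\<lambda>m. ip e (y m)) \<longlonglongrightarrow> l" if "e \<in> G" for e
    using s(2)[OF that] by (simp add: convergent_def y_def)
  then obtain l where l: "\<And>e. e \<in> G \<Longrightarrow> (\<lambda>m. ip e (y m)) \<longlonglongrightarrow> l e" by metis
  have bl: "bounded_linear (\<lambda>c. scale c e)" for e
    by (rule bounded_linear_intro[of _ "norm e"])
       (simp_all add: scale_left_distrib norm_scale scaleR_eq scaleR_conv_of_real)
  have ulim: "u \<longlonglongrightarrow> (\<Sum>e\<in>G. scale (l e) e)"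
    unfolding u_def proj_def by (intro tendsto_sum bounded_linear.tendsto[OF bl] l)
  then have uC: "Cauchy u" by (rule LIMSEQ_imp_Cauchy)
  define q where "q = (\<lambda>w. (norm w)\<^sup>2 - (norm (?T w))\<^sup>2)"
  have q0: "q w \<ge> 0" for w using norm_apply_le[OF T(2), of w] by (simp add: q_def power_mono)
  have qle: "q w \<le> (norm w)\<^sup>2" for w by (simp add: q_def)
  \<comment> \<open>\<open>q\<close> satisfies the parallelogram law as a difference of two squared
    norms; the nonnegative term \<open>q (a + b)\<close> is dropped.\<close>
  have q_diff: "q (a - b) \<le> 2 * q a + 2 * q b" for a b
  proof -
    have "q (a + b) + q (a - b) = 2 * q a + 2 * q b"
      using parallelogram[of a b] parallelogram[of "?T a" "?T b"]
      by (simp add: q_def blinfun.add_right blinfun.diff_right)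
    then show ?thesis using q0[of "a + b"] by simp
  qed
  obtain r where r: "0 \<le> r" "r < 1" "\<And>w. w \<in> perp G \<Longrightarrow> norm (?T w) \<le> r * norm w"
    using G(3) by (auto simp: gap_def)
  define d where "d = 1 - r\<^sup>2"
  have "r\<^sup>2 < 1" using r by (simp add: power_less_one_iff)
  then have d: "d > 0" by (simp add: d_def)
  have coercive: "d * (norm w)\<^sup>2 \<le> q w" if "w \<in> perp G" for w
    using power_mono[OF r(3)[OF that], of 2] by (simp add: q_def d_def power_mult_distrib algebra_simps)
  have v: "v m \<in> perp G" for m using diff_proj_perp[OF G(2,1)] by (simp add: v_def u_def)
  have "(\<lambda>m. 1 - (norm (?T (y m)))\<^sup>2) \<longlonglongrightarrow> 1 - 1\<^sup>2" by (intro tendsto_intros ylim)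
  then have qlim: "(\<lambda>m. q (y m)) \<longlonglongrightarrow> 0" by (simp add: q_def y)
  \<comment> \<open>\<open>v m - v n\<close> is the difference of \<open>y m - y n\<close> and
    \<open>u m - u n\<close>, so coercivity and \<open>q_diff\<close> reduce the Cauchy property of
    \<open>v\<close> to \<open>qlim\<close> and that of \<open>u\<close>.\<close>
  have key: "d * (norm (v m - v n))\<^sup>2 \<le> 4 * q (y m) + 4 * q (y n) + 2 * (norm (u m - u n))\<^sup>2" for m n
  proof -
    have "d * (norm (v m - v n))\<^sup>2 \<le> q ((y m - y n) - (u m - u n))"
      using coercive[OF subspace_diff[OF subspace_perp v v], of m n] by (simp add: v_def algebra_simps)
    also have "\<dots> \<le> 2 * q (y m - y n) + 2 * q (u m - u n)" by (rule q_diff)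
    also have "\<dots> \<le> 2 * (2 * q (y m) + 2 * q (y n)) + 2 * (norm (u m - u n))\<^sup>2"
      by (intro add_mono mult_left_mono q_diff qle) auto
    finally show ?thesis by simp
  qed
  have "Cauchy v"
    unfolding Cauchy_def
  proof (intro allI impI)
    fix e :: real assume e: "e > 0"
    \<comment> \<open>In \<open>key\<close> the terms in \<open>q\<close> then stay below
      \<open>d * e\<^sup>2 / 2\<close> and the term in \<open>u\<close> below
      \<open>d * e\<^sup>2 / 4\<close>.\<close>
    have "eventually (\<lambda>m. q (y m) < d * e\<^sup>2 / 16) sequentially"
      using qlim d e by (intro order_tendstoD(2)) auto
    then obtain M where M: "\<And>m. m \<ge> M \<Longrightarrow> q (y m) < d * e\<^sup>2 / 16" by (auto simp: eventually_sequentially)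
    have "sqrt (d / 8) * e > 0" using d e by simp
    then obtain N where N: "\<And>m n. m \<ge> N \<Longrightarrow> n \<ge> N \<Longrightarrow> dist (u m) (u n) < sqrt (d / 8) * e"
      using uC unfolding Cauchy_def by metis
    have "dist (v m) (v n) < e" if mn: "m \<ge> max M N" "n \<ge> max M N" for m n
    proof -
      have "(norm (u m - u n))\<^sup>2 < (sqrt (d / 8) * e)\<^sup>2"
        using N[of m n] mn by (intro power_strict_mono) (auto simp: dist_norm)
      also have "\<dots> = d * e\<^sup>2 / 8" using d by (simp add: power_mult_distrib)
      finally have "d * (norm (v m - v n))\<^sup>2 < d * e\<^sup>2"
        using key[of m n] M[of m] M[of n] mn mult_pos_pos[OF d, of "e\<^sup>2"] e by simp
      then have "(norm (v m - v n))\<^sup>2 < e\<^sup>2" using d by simp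
      then show ?thesis using e by (simp add: dist_norm power_less_imp_less_base)
    qed
    then show "\<exists>M. \<forall>m\<ge>M. \<forall>n\<ge>M. dist (v m) (v n) < e" by blast
  qed
  then obtain z where "v \<longlonglongrightarrow> z" using Cauchy_convergent convergent_def by blast
  from tendsto_add[OF ulim this] obtain z where z: "y \<longlonglongrightarrow> z" by (auto simp: v_def)
  have "norm z = 1" using tendsto_norm[OF z] y(2) LIMSEQ_unique[OF _ tendsto_const] by auto
  moreover have "norm (?T z) = 1"
    using LIMSEQ_unique[OF tendsto_norm[OF blinfun.tendsto[OF tendsto_const z]] ylim] .
  ultimately have z_isom: "z \<in> isom T" by (simp add: isom_def)
  \<comment> \<open>The limit \<open>z\<close> lies in \<open>isom T\<close> yet is a limit of
    vectors orthogonal to \<open>isom T\<close>, so it is orthogonal to itself.\<close>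
  have "(\<lambda>m. ip z (y m)) \<longlonglongrightarrow> ip z z" by (intro ip.tendsto tendsto_const z)
  moreover have "ip z (y m) = 0" for m using y(1)[of m] z_isom by (simp add: perp_def)
  ultimately have "ip z z = 0" using LIMSEQ_unique[OF _ tendsto_const[of 0]] by simp
  then show False using \<open>norm z = 1\<close> by (simp add: ip_self)
qed

text \<open>The converse direction up to the value of \<open>k\<close>, which is recovered
  afterwards through \<open>smooth_unique\<close>.\<close>

lemma smooth_isom:
  assumes T: "T \<in> ops" "norm T = 1" and "smooth k T"
  obtains E where "finite E" "orthonormal E" "span E = isom T" "gap T (perp (isom T))"
proof -
  from assms(3) obtain S where S: "finite S" "F.span S = F.span (support T)"
    by (auto simp: smooth_def)
  then have S': "support T \<subseteq> F.span S" by (simp add: F.span_superset)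
  have iso: "subspace (isom T)" using T by (intro subspace_isom) auto
  obtain E where E: "finite E" "orthonormal E" "span E = isom T"
    using orthonormal_basis_exists[OF iso isom_orthonormal_card[OF T S(1) S']] by blast
  obtain G where "finite G" "orthonormal G" "gap T (perp G)"
    using finite_codimensional_gap[OF T S(1) S'] by blast
  then have "gap T (perp (isom T))" using gap_perp_isom T by simp
  with E that show thesis by blast
qed

section \<open>Translation to the norm attaining set and the restricted norm\<close>

lemma norm_attaining_eq_iff:
  assumes T: "T \<in> ops" "norm T = 1" and V: "subspace V"
  shows "norm_attaining_set T = unit_sphere_of V \<longleftrightarrow> V = isom T"
proof
  assume eq: "norm_attaining_set T = unit_sphere_of V"
  have iso: "subspace (isom T)" using T by (intro subspace_isom) auto
  have "x \<in> V \<longleftrightarrow> x \<in> isom T" for x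
  proof (cases "x = 0")
    case True
    then show ?thesis using V iso by (auto simp: subspace_0)
  next
    case False
    define e where "e = scale (of_real (1 / norm x)) x"
    have e: "norm e = 1" using False by (simp add: e_def norm_scale norm_divide)
    have x: "x = scale (of_real (norm x)) e" using False by (simp add: e_def flip: of_real_mult)
    have "x \<in> W \<longleftrightarrow> e \<in> W" if "subspace W" for W
      using subspace_scale[OF that, of e "of_real (norm x)"] subspace_scale[OF that, of x "of_real (1 / norm x)"] x
      by (auto simp: e_def)
    moreover have "e \<in> V \<longleftrightarrow> e \<in> isom T"
      using eq e T by (auto simp: norm_attaining_set_def unit_sphere_of_def isom_def set_eq_iff)
    ultimately show ?thesis using V iso by blast
  qed
  then show "V = isom T" by blast
next
  assume "V = isom T"
  then show "norm_attaining_set T = unit_sphere_of V"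
    using T by (auto simp: norm_attaining_set_def unit_sphere_of_def isom_def)
qed

text \<open>By homogeneity the supremum itself serves as the constant of \<open>gap\<close>. The
  vector 0 keeps the set of values nonempty and the supremum nonnegative, even for trivial
  \<open>V\<close>.\<close>

lemma restr_norm_less_iff:
  assumes "subspace V"
  shows "restr_norm T V < 1 \<longleftrightarrow> gap T V"
proof -
  let ?X = "{norm (blinfun_apply T x) |x. x \<in> V \<and> norm x \<le> 1}"
  have ne: "0 \<in> ?X" using subspace_0[OF assms] by (auto intro!: exI[of _ 0])
  have bdd: "bdd_above ?X"
  proof (rule bdd_aboveI)
    fix t assume "t \<in> ?X"
    then obtain x where "t = norm (blinfun_apply T x)" "norm x \<le> 1" by blast
    then show "t \<le> norm T" using norm_blinfun[of T x] mult_left_mono[of "norm x" 1 "norm T"] by simp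
  qed
  show ?thesis
  proof
    assume less: "restr_norm T V < 1"
    have "norm (blinfun_apply T x) \<le> restr_norm T V * norm x" if "x \<in> V" for x
    proof (cases "x = 0")
      case False
      define e where "e = scale (of_real (1 / norm x)) x"
      have eR: "e = (1 / norm x) *\<^sub>R x" by (simp add: e_def scaleR_eq)
      have "e \<in> V" unfolding e_def by (rule subspace_scale[OF assms that])
      moreover have "norm e = 1" using False by (simp add: eR)
      ultimately have "norm (blinfun_apply T e) \<le> restr_norm T V"
        unfolding restr_norm_def by (intro cSup_upper bdd) auto
      then show ?thesis using False by (simp add: eR blinfun.scaleR_right field_simps)
    qed simp
    moreover have "restr_norm T V \<ge> 0" unfolding restr_norm_def by (rule cSup_upper[OF ne bdd])
    ultimately show "gap T V" using less by (auto simp: gap_def)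
  next
    assume "gap T V"
    then obtain r where r: "0 \<le> r" "r < 1" "\<And>x. x \<in> V \<Longrightarrow> norm (blinfun_apply T x) \<le> r * norm x"
      by (auto simp: gap_def)
    have "restr_norm T V \<le> r"
      unfolding restr_norm_def
    proof (rule cSup_least)
      fix t assume "t \<in> ?X"
      then obtain x where "t = norm (blinfun_apply T x)" "x \<in> V" "norm x \<le> 1" by blast
      then show "t \<le> r" using r(3)[of x] mult_left_mono[of "norm x" 1 r] r(1) by simp
    qed (use ne in blast)
    then show "restr_norm T V < 1" using r by simp
  qed
qed

text \<open>The function \<open>\<delta>\<close> gives the dimension of the space spanned by the support functionals in terms of the
  dimension of \<^term>\<open>isom T\<close>.\<close>

lemma smooth_iff:
  fixes \<delta> :: "nat \<Rightarrow> nat"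
  assumes T: "T \<in> ops" "norm T = 1" and "inj \<delta>"
    and \<delta>: "\<And>E. finite E \<Longrightarrow> orthonormal E \<Longrightarrow> span E = isom T \<Longrightarrow> gap T (perp (isom T)) \<Longrightarrow> smooth (\<delta> (card E)) T"
  shows "smooth (\<delta> n) T \<longleftrightarrow>
    (\<exists>V. (subspace V \<and> (\<exists>B. finite B \<and> card B = n \<and> independent B \<and> span B = V)) \<and>
      norm_attaining_set T = unit_sphere_of V \<and> restr_norm T (perp V) < 1)"
    (is "?l \<longleftrightarrow> ?r")
proof
  assume ?l
  then obtain E where E: "finite E" "orthonormal E" "span E = isom T" and gap: "gap T (perp (isom T))"
    using smooth_isom[OF T] by blast
  \<comment> \<open>The span has a single dimension, equal to both \<open>\<delta> n\<close> and
    \<open>\<delta> (card E)\<close>.\<close>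
  have "n = card E"
    using smooth_unique[OF \<open>?l\<close> \<delta>[OF E gap]] \<open>inj \<delta>\<close> by (simp add: inj_eq)
  then show ?r
    using E gap orthonormal_independent[OF E(2,1)] subspace_span[of E] norm_attaining_eq_iff[OF T]
      restr_norm_less_iff[OF subspace_perp]
    by (intro exI[of _ "isom T"]) auto
next
  assume ?r
  then obtain V B where V: "subspace V" "norm_attaining_set T = unit_sphere_of V" "restr_norm T (perp V) < 1"
    and B: "finite B" "card B = n" "independent B" "span B = V" by blast
  have iso: "V = isom T" using norm_attaining_eq_iff[OF T V(1)] V(2) by simp
  have gap: "gap T (perp (isom T))" using V(3) restr_norm_less_iff[OF subspace_perp] iso by simp
  obtain E where E: "finite E" "orthonormal E" "span E = V"
    using orthonormal_basis[OF V(1) B(1,4)] by blast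
  have "card E = n"
    using B E orthonormal_independent[OF E(2,1)] by (metis dim_span dim_eq_card_independent)
  then show ?l using \<delta>[OF E(1,2) _ gap] E(3) iso by simp
qed

end

section \<open>The real and the complex case\<close>

text \<open>Consecutive values differ by \<open>n + 1\<close>; injectivity lets the order of
  smoothness determine the dimension of the subspace.\<close>

lemma inj_choose_two: "inj (\<lambda>n::nat. (n + 1) choose 2)"
proof -
  have "strict_mono (\<lambda>n::nat. (n + 1) choose 2)"
    by (rule strict_monoI_Suc) (simp add: numeral_2_eq_2)
  then show ?thesis by (rule strict_mono_imp_inj_on)
qed

section \<open>The real instance\<close>

interpretation real: hilbert_over scaleR "inner :: 'b::{real_inner,complete_space} \<Rightarrow> 'b \<Rightarrow> real" "\<lambda>c. c"
  by unfold_locales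
    (auto simp: inner_add_left inner_commute dot_square_norm algebra_simps power2_eq_square)

lemma real_ops [simp]: "T \<in> real.ops"
  by (simp add: real.ops_def blinfun.scaleR_right)

text \<open>A function in \<open>real.support T\<close> is linear with bound 1, hence the
  application of a blinfun, and its value at \<open>T\<close> makes the norm exactly 1.\<close>

lemma real_support:
  fixes T :: "'b::{real_inner,complete_space} \<Rightarrow>\<^sub>L 'b"
  assumes "norm T = 1"
  shows "real.support T = blinfun_apply ` rJ T"
proof (intro set_eqI iffI)
  fix f assume f: "f \<in> real.support T"
  have sc: "real.op_scale c A = c *\<^sub>R A" for c and A :: "'b \<Rightarrow>\<^sub>L 'b"
    by (rule blinfun_eqI) (simp add: blinfun.scaleR_left)
  have le: "norm (f A) \<le> norm A" for A using f by (simp add: real.support_def)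
  have lin: "bounded_linear f"
    using f le sc by (intro bounded_linear_intro[of f 1]) (auto simp: real.support_def real.dual_def)
  define g where "g = Blinfun f"
  have g: "blinfun_apply g = f" unfolding g_def by (rule bounded_linear_Blinfun_apply[OF lin])
  have gT: "blinfun_apply g T = 1" using f g by (simp add: real.support_def)
  moreover have "norm g = 1"
  proof (rule antisym)
    show "norm g \<le> 1" using le g by (intro norm_blinfun_bound) auto
    show "1 \<le> norm g" using norm_blinfun[of g T] gT assms by simp
  qed
  ultimately show "f \<in> blinfun_apply ` rJ T" using g by (auto simp: rJ_def)
next
  fix f assume "f \<in> blinfun_apply ` rJ T"
  then obtain g where g: "f = blinfun_apply g" "norm g = 1" "blinfun_apply g T = 1" by (auto simp: rJ_def)
  have sc: "real.op_scale c A = c *\<^sub>R A" for c and A :: "'b \<Rightarrow>\<^sub>L 'b"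
    by (rule blinfun_eqI) (simp add: blinfun.scaleR_left)
  show "f \<in> real.support T"
    using g norm_blinfun[of g] by (auto simp: real.support_def real.dual_def blinfun.add_right sc blinfun.scaleR_right)
qed

text \<open>This linear map is injective, so spans and independence transfer between blinfuns and
  plain functions.\<close>

interpretation ba: Vector_Spaces.linear scaleR "fscale :: real \<Rightarrow> _"
    "blinfun_apply :: ('c::real_normed_vector \<Rightarrow>\<^sub>L real) \<Rightarrow> 'c \<Rightarrow> real"
  by unfold_locales (auto simp: fscale_def fun_eq_iff blinfun.add_left blinfun.scaleR_left algebra_simps)

lemma real_smooth:
  fixes T :: "'b::{real_inner,complete_space} \<Rightarrow>\<^sub>L 'b"
  assumes "norm T = 1"
  shows "r_k_smooth k T \<longleftrightarrow> real.smooth k T"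
proof -
  let ?a = "blinfun_apply :: (('b \<Rightarrow>\<^sub>L 'b) \<Rightarrow>\<^sub>L real) \<Rightarrow> _"
  have inj: "inj_on ?a X" for X by (auto simp: inj_on_def blinfun_apply_inject)
  have span: "F.span (?a ` X) = ?a ` span X" for X
    unfolding span_raw_def by (rule ba.span_image)
  have indep: "F.independent (?a ` X) \<longleftrightarrow> independent X" for X
  proof -
    have diff: "?a ` X - {?a x} = ?a ` (X - {x})" for x by (auto simp: blinfun_apply_inject)
    show ?thesis
      by (simp add: F.dependent_def real_vector.dependent_def diff span inj_image_mem_iff[OF inj])
  qed
  show ?thesis
  proof
    assume "r_k_smooth k T"
    then obtain B where "finite B" "card B = k" "independent B" "span B = span (rJ T)"
      by (auto simp: r_k_smooth_def)
    then show "real.smooth k T"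
      unfolding real.smooth_def real_support[OF assms]
      by (intro exI[of _ "?a ` B"]) (simp add: span indep card_image[OF inj])
  next
    assume "real.smooth k T"
    then obtain B where B: "finite B" "card B = k" "F.independent B" "F.span B = ?a ` span (rJ T)"
      unfolding real.smooth_def real_support[OF assms] span by blast
    \<comment> \<open>A basis of plain functions lies in the span, hence in the range of the
      embedding, and can be pulled back.\<close>
    have "B \<subseteq> ?a ` span (rJ T)" using B(4) F.span_superset by blast
    then obtain C where C: "B = ?a ` C" by (auto simp: subset_image_iff)
    have "span C = span (rJ T)"
      using B(4) inj_image_eq_iff[OF inj] unfolding C span by blast
    then show "r_k_smooth k T"
      using B(1-3) assms unfolding C indep r_k_smooth_def card_image[OF inj] finite_image_iff[OF inj] by blast
  qed
qed

section \<open>The complex instance\<close>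

interpretation complex: hilbert_over scaleC
    "cinner :: 'a::{complex_inner,complete_space} \<Rightarrow> 'a \<Rightarrow> complex" cnj
proof
  show "cnj c * c = of_real ((cmod c)\<^sup>2)" for c
    by (metis complex_norm_square mult.commute)
  show "cnj (cinner y x) = cinner x y" for x y :: 'a by (rule cinner_cnj[symmetric])
qed (simp_all add: scaleC_add_right scaleC_add_left scaleC_scaleC scaleC_one scaleR_scaleC
      cinner_add_left cinner_scaleC_left cinner_self_norm)

lemma complex_ops: "complex.ops = cbounded_ops"
  by (simp add: complex.ops_def cbounded_ops_def)

text \<open>For a bounded functional with value 1 at \<open>T\<close>, having supremum norm 1
  amounts to the bound by \<open>norm A\<close>, by rescaling to the unit ball. That bound in turn
  gives the boundedness clause of \<open>cdual\<close> with constant 1.\<close>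

lemma complex_support:
  fixes T :: "'a::{complex_inner,complete_space} \<Rightarrow>\<^sub>L 'a"
  assumes T: "T \<in> cbounded_ops" "norm T = 1"
  shows "complex.support T = cJ T"
proof -
  have op: "(\<forall>x. blinfun_apply B x = scaleC c (blinfun_apply A x)) \<longleftrightarrow> B = complex.op_scale c A"
    for A B :: "'a \<Rightarrow>\<^sub>L 'a" and c by (auto intro: blinfun_eqI)
  have dual: "cdual = {f \<in> complex.dual. \<exists>K. \<forall>A\<in>cbounded_ops. cmod (f A) \<le> K * norm (A :: 'a \<Rightarrow>\<^sub>L 'a)}"
    unfolding cdual_def complex.dual_def op complex_ops
    using complex.op_scale_ops[unfolded complex_ops] by blast
  have zero: "(0 :: 'a \<Rightarrow>\<^sub>L 'a) \<in> cbounded_ops" using complex.ops_zero by (simp add: complex_ops)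
  have norm_iff: "cdual_norm f = 1 \<longleftrightarrow> (\<forall>A\<in>cbounded_ops. cmod (f A) \<le> norm A)"
    if f: "f \<in> complex.dual" "f T = 1" and K: "\<forall>A\<in>cbounded_ops. cmod (f A) \<le> K * norm A" for f K
  proof -
    let ?X = "{cmod (f A) |A. A \<in> cbounded_ops \<and> norm A \<le> 1}"
    have bdd: "bdd_above ?X"
    proof (rule bdd_aboveI)
      fix t assume "t \<in> ?X"
      then obtain A where "t = cmod (f A)" "A \<in> cbounded_ops" "norm A \<le> 1" by blast
      then show "t \<le> \<bar>K\<bar>"
        using K mult_mono[of K "\<bar>K\<bar>" "norm A" 1] by fastforce
    qed
    \<comment> \<open>\<open>T\<close> lies in the unit ball and produces the value 1, so the
      supremum is a maximum once all values are at most 1.\<close>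
    have one: "1 \<in> ?X" using f(2) T by (auto intro!: exI[of _ T])
    show ?thesis
    proof
      assume eq: "cdual_norm f = 1"
      show "\<forall>A\<in>cbounded_ops. cmod (f A) \<le> norm A"
      proof
        fix A :: "'a \<Rightarrow>\<^sub>L 'a" assume A: "A \<in> cbounded_ops"
        show "cmod (f A) \<le> norm A"
        proof (cases "A = 0")
          case True
          then show ?thesis using complex.dual_zero[OF f(1)] by simp
        next
          case False
          define B where "B = complex.op_scale (of_real (1 / norm A)) A"
          have BR: "B = (1 / norm A) *\<^sub>R A"
            by (rule blinfun_eqI) (simp add: B_def blinfun.scaleR_left scaleR_scaleC)
          have "B \<in> cbounded_ops"
            using A complex.op_scale_ops by (simp add: B_def flip: complex_ops)
          moreover have "norm B = 1" using False by (simp add: BR)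
          ultimately have "cmod (f B) \<le> cdual_norm f"
            unfolding cdual_norm_def by (intro cSup_upper bdd) auto
          then have "cmod (f B) \<le> 1" by (simp add: eq)
          moreover have "f B = of_real (1 / norm A) * f A"
            unfolding B_def using A by (intro complex.dual_op_scale[OF f(1)]) (simp add: complex_ops)
          ultimately show ?thesis using False by (simp add: norm_mult norm_divide field_simps)
        qed
      qed
    next
      assume le: "\<forall>A\<in>cbounded_ops. cmod (f A) \<le> norm A"
      show "cdual_norm f = 1"
        unfolding cdual_norm_def
      proof (rule cSup_eq_maximum[OF one])
        fix t assume "t \<in> ?X"
        then obtain A where "t = cmod (f A)" "A \<in> cbounded_ops" "norm A \<le> 1" by blast
        then show "t \<le> 1" using le by force
      qed
    qed
  qed
  show ?thesis
    unfolding complex.support_def cJ_def dual complex_ops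
    using norm_iff norm_iff[of _ 1] by (auto intro: exI[of _ 1])
qed

lemma fscaleC_eq: "fscaleC = fscale"
  by (simp add: fun_eq_iff fscaleC_def fscale_def)

lemma complex_smooth:
  fixes T :: "'a::{complex_inner,complete_space} \<Rightarrow>\<^sub>L 'a"
  assumes "T \<in> cbounded_ops" "norm T = 1"
  shows "c_k_smooth k T \<longleftrightarrow> complex.smooth k T"
  using assms by (simp add: c_k_smooth_def complex.smooth_def complex_support fscaleC_eq)

theorem theorem2p4:
  shows "(separable TYPE('a::{complex_inner, complete_space}) \<longrightarrow>
           (\<forall>(T::'a \<Rightarrow>\<^sub>L 'a) (n::nat). T \<in> cbounded_ops \<and> norm T = 1 \<longrightarrow>
              (c_k_smooth (n\<^sup>2) T \<longleftrightarrow>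
                 (\<exists>H0. csubspace_dim H0 n \<and> norm_attaining_set T = unit_sphere_of H0 \<and>
                       restr_norm T (corth_comp H0) < 1)))) \<and>
         (separable TYPE('b::{real_inner, complete_space}) \<longrightarrow>
           (\<forall>(T::'b \<Rightarrow>\<^sub>L 'b) (n::nat). norm T = 1 \<longrightarrow>
              (r_k_smooth ((n + 1) choose 2) T \<longleftrightarrow>
                 (\<exists>H0. rsubspace_dim H0 n \<and> norm_attaining_set T = unit_sphere_of H0 \<and>
                       restr_norm T (orthogonal_comp H0) < 1))))"
proof (intro conjI impI allI)
  fix T :: "'a \<Rightarrow>\<^sub>L 'a" and n :: nat assume "T \<in> cbounded_ops \<and> norm T = 1"
  then have T: "T \<in> cbounded_ops" "T \<in> complex.ops" "norm T = 1" by (auto simp: complex_ops)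
  have perp: "complex.perp = corth_comp"
    by (simp add: fun_eq_iff complex.perp_def corth_comp_def)
  have "complex.smooth (n\<^sup>2) T \<longleftrightarrow> (\<exists>H0. csubspace_dim H0 n \<and> norm_attaining_set T = unit_sphere_of H0 \<and>
      restr_norm T (corth_comp H0) < 1)"
    unfolding csubspace_dim_def perp[symmetric]
  proof (rule complex.smooth_iff[OF T(2,3)])
    show "inj (\<lambda>n::nat. n\<^sup>2)" by (auto simp: inj_on_def)
    show "complex.smooth ((card E)\<^sup>2) T"
      if "finite E" "complex.orthonormal E" "complex.span E = complex.isom T"
        "complex.gap T (complex.perp (complex.isom T))" for E
      \<comment> \<open>The imaginary unit has norm 1 and is negated by \<open>cnj\<close>, as
        required of \<open>\<iota>\<close>.\<close>
      by (rule complex.smooth_hermitian[of \<i>]) (use T that in auto)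
  qed
  then show "c_k_smooth (n\<^sup>2) T \<longleftrightarrow> (\<exists>H0. csubspace_dim H0 n \<and>
      norm_attaining_set T = unit_sphere_of H0 \<and> restr_norm T (corth_comp H0) < 1)"
    by (simp add: complex_smooth T)
next
  fix T :: "'b \<Rightarrow>\<^sub>L 'b" and n :: nat assume T: "norm T = 1"
  have perp: "real.perp = orthogonal_comp"
    by (simp add: fun_eq_iff real.perp_def orthogonal_comp_def orthogonal_def)
  have "real.smooth ((n + 1) choose 2) T \<longleftrightarrow> (\<exists>H0. rsubspace_dim H0 n \<and>
      norm_attaining_set T = unit_sphere_of H0 \<and> restr_norm T (orthogonal_comp H0) < 1)"
    unfolding rsubspace_dim_def perp[symmetric] subspace_raw_def dependent_raw_def span_raw_def
    by (rule real.smooth_iff[OF real_ops T inj_choose_two real.smooth_symmetric[OF _ real_ops T]]) auto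
  then show "r_k_smooth ((n + 1) choose 2) T \<longleftrightarrow> (\<exists>H0. rsubspace_dim H0 n \<and>
      norm_attaining_set T = unit_sphere_of H0 \<and> restr_norm T (orthogonal_comp H0) < 1)"
    by (simp add: real_smooth T)
qed

end
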